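(* Let $(X,d)$ be a compact metric space without isolated points and let $T\colon X\to X$ be a transitive continuous map which is not uniquely ergodic and satisfies the shadowing property. Then: (a) $\mathcal{H}(X,T)\neq\emptyset$. (b) $T$ has positive topological entropy. (c) $\mathcal{M}(X,T)=X$. (d) $\bigcup_{\mu\in\mathcal{P}_T^{erg}(X)}\mathcal{B}(\mu)$ is dense in $X$. (e) $\mathcal{CI}(X,T)$ is Baire generic in $X$. (f) $T$ has sensitivity to initial conditions.
   Context: $\mathbb{N}=\{1,2,\dots\}$. $T$ is transitive if for all nonempty open $U,V\subset X$ there is $n\in\mathbb{N}$ with $U\cap T^{-n}(V)\ne\emptyset$. A sequence $\{x_n\}_{n\in\mathbb{N}}\subset X$ is a $\delta$-pseudo-orbit if $d(T(x_n),x_{n+1})<\delta$ for all $n\in\mathbb{N}$; it is $\varepsilon$-shadowed if there is $y\in X$ with $d(T^n(y),x_n)<\varepsilon$ for all $n\in\mathbb{N}$. $T$ has the shadowing property if for every $\varepsilon>0$ there is $\delta>0$ such that every $\delta$-pseudo-orbit is $\varepsilon$-shadowed. $T$ has sensitivity to initial conditions if there is $\varepsilon>0$ such that for every $x\in X$ and $\delta>0$ there is $z$ in the ball $B(x,\delta)$ with $\sup_{n\in\mathbb{N}}d(T^n(x),T^n(z))>\varepsilon$. $\mathcal{P}_T(X)$ is the space of $T$-invariant Borel probability measures on $X$ (weak$^*$ topology), $\mathcal{P}_T^{erg}(X)$ its ergodic elements; $T$ is uniquely ergodic if $\mathcal{P}_T(X)$ has exactly one element. The measure center is $\mathcal{M}(X,T)=\overline{\bigcup_{\mu\in\mathcal{P}_T(X)}\operatorname{supp}\mu}$.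 The basin of attraction of $\mu\in\mathcal{P}_T(X)$ is $\mathcal{B}(\mu)=\{x\in X\colon\lim_{n\to+\infty}\frac1n\sum_{j=0}^{n-1}\psi(T^j(x))=\int\psi\,d\mu\ \ \forall\psi\in C^0(X,\mathbb{R})\}$. For $\varphi\in C^0(X,\mathbb{R})$ (continuous real-valued functions), $\mathcal{I}(T,\varphi)$ is the set of $x\in X$ such that $\big(\frac1n\sum_{j=0}^{n-1}\varphi(T^j(x))\big)_{n\ge1}$ does not converge; $\mathcal{H}(X,T)=\{\varphi\in C^0(X,\mathbb{R})\colon\mathcal{I}(T,\varphi)\neq\emptyset\}$; $\mathcal{CI}(X,T)=\bigcap_{\varphi\in\mathcal{H}(X,T)}\mathcal{I}(T,\varphi)$. A set is Baire generic in $X$ if it contains a countable intersection of open dense subsets of $X$. *)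

theory Defs
  imports "HOL-Probability.Probability"
begin

text \<open>
  The phase space is a whole type of class \<^class>\<open>metric_space\<close>; its compactness is assumed
  explicitly as \<open>compact UNIV\<close> in the theorem. The natural numbers of the source start at 1, which
  accounts for the guards \<open>n \<ge> 1\<close>; in sequences indexed by \<^typ>\<open>nat\<close> the entry at 0 is unused.
\<close>

definition top_transitive :: "('a::metric_space \<Rightarrow> 'a) \<Rightarrow> bool" where
  "top_transitive T \<longleftrightarrow>
     (\<forall>U V. open U \<and> U \<noteq> {} \<and> open V \<and> V \<noteq> {} \<longrightarrow> (\<exists>n\<ge>1. U \<inter> (T ^^ n) -` V \<noteq> {}))"

definition pseudo_orbit :: "('a::metric_space \<Rightarrow> 'a) \<Rightarrow> real \<Rightarrow> (nat \<Rightarrow> 'a) \<Rightarrow> bool" where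
  "pseudo_orbit T \<delta> x \<longleftrightarrow> (\<forall>n\<ge>1. dist (T (x n)) (x (Suc n)) < \<delta>)"

definition shadowed :: "('a::metric_space \<Rightarrow> 'a) \<Rightarrow> real \<Rightarrow> (nat \<Rightarrow> 'a) \<Rightarrow> bool" where
  "shadowed T \<epsilon> x \<longleftrightarrow> (\<exists>y. \<forall>n\<ge>1. dist ((T ^^ n) y) (x n) < \<epsilon>)"

definition shadowing_property :: "('a::metric_space \<Rightarrow> 'a) \<Rightarrow> bool" where
  "shadowing_property T \<longleftrightarrow>
     (\<forall>\<epsilon>>0. \<exists>\<delta>>0. \<forall>x. pseudo_orbit T \<delta> x \<longrightarrow> shadowed T \<epsilon> x)"

text \<open>The supremum is taken in \<^typ>\<open>ereal\<close>, where it is meaningful without boundedness.\<close>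

definition sensitive :: "('a::metric_space \<Rightarrow> 'a) \<Rightarrow> bool" where
  "sensitive T \<longleftrightarrow>
     (\<exists>\<epsilon>>0. \<forall>x. \<forall>\<delta>>0. \<exists>z\<in>ball x \<delta>.
        (SUP n\<in>{1..}. ereal (dist ((T ^^ n) x) ((T ^^ n) z))) > ereal \<epsilon>)"

definition invariant_measures :: "('a::metric_space \<Rightarrow> 'a) \<Rightarrow> 'a measure set" where
  "invariant_measures T = {\<mu>. sets \<mu> = sets borel \<and> prob_space \<mu> \<and> distr \<mu> borel T = \<mu>}"

definition ergodic_measures :: "('a::metric_space \<Rightarrow> 'a) \<Rightarrow> 'a measure set" where
  "ergodic_measures T =
     {\<mu> \<in> invariant_measures T.
        \<forall>A\<in>sets borel. T -` A = A \<longrightarrow> measure \<mu> A = 0 \<or> measure \<mu> A = 1}"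

definition uniquely_ergodic :: "('a::metric_space \<Rightarrow> 'a) \<Rightarrow> bool" where
  "uniquely_ergodic T \<longleftrightarrow> (\<exists>!\<mu>. \<mu> \<in> invariant_measures T)"

definition measure_support :: "'a::metric_space measure \<Rightarrow> 'a set" where
  "measure_support \<mu> = {x. \<forall>U. open U \<and> x \<in> U \<longrightarrow> emeasure \<mu> U > 0}"

definition measure_center :: "('a::metric_space \<Rightarrow> 'a) \<Rightarrow> 'a set" where
  "measure_center T = closure (\<Union>\<mu>\<in>invariant_measures T. measure_support \<mu>)"

definition birkhoff_average ::
    "('a::metric_space \<Rightarrow> 'a) \<Rightarrow> ('a \<Rightarrow> real) \<Rightarrow> 'a \<Rightarrow> nat \<Rightarrow> real" where
  "birkhoff_average T \<phi> x n = (\<Sum>j<n. \<phi> ((T ^^ j) x)) / real n"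

definition basin :: "('a::metric_space \<Rightarrow> 'a) \<Rightarrow> 'a measure \<Rightarrow> 'a set" where
  "basin T \<mu> =
     {x. \<forall>\<psi>. continuous_on UNIV \<psi> \<longrightarrow> birkhoff_average T \<psi> x \<longlonglongrightarrow> (\<integral>y. \<psi> y \<partial>\<mu>)}"

definition irregular_points :: "('a::metric_space \<Rightarrow> 'a) \<Rightarrow> ('a \<Rightarrow> real) \<Rightarrow> 'a set" where
  "irregular_points T \<phi> = {x. \<not> convergent (birkhoff_average T \<phi> x)}"

definition irregular_observables :: "('a::metric_space \<Rightarrow> 'a) \<Rightarrow> ('a \<Rightarrow> real) set" where
  "irregular_observables T = {\<phi>. continuous_on UNIV \<phi> \<and> irregular_points T \<phi> \<noteq> {}}"

definition completely_irregular_points :: "('a::metric_space \<Rightarrow> 'a) \<Rightarrow> 'a set" where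
  "completely_irregular_points T = (\<Inter>\<phi>\<in>irregular_observables T. irregular_points T \<phi>)"

definition baire_generic :: "'a::metric_space set \<Rightarrow> bool" where
  "baire_generic S \<longleftrightarrow>
     (\<exists>\<G>. countable \<G> \<and> (\<forall>G\<in>\<G>. open G \<and> closure G = UNIV) \<and> \<Inter>\<G> \<subseteq> S)"

definition separated_set :: "('a::metric_space \<Rightarrow> 'a) \<Rightarrow> nat \<Rightarrow> real \<Rightarrow> 'a set \<Rightarrow> bool" where
  "separated_set T n \<epsilon> E \<longleftrightarrow>
     (\<forall>x\<in>E. \<forall>y\<in>E. x \<noteq> y \<longrightarrow> (\<exists>j<n. dist ((T ^^ j) x) ((T ^^ j) y) > \<epsilon>))"

text \<open>
  Bowen's definition of topological entropy:
  \<open>lim (\<epsilon> \<rightarrow> 0) limsup (n \<rightarrow> \<infinity>) (1/n) log s(n,\<epsilon>)\<close>, where \<open>s(n,\<epsilon>)\<close> is the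
  largest cardinality of an \<open>(n,\<epsilon>)\<close>-separated set. The limit as \<open>\<epsilon>\<close> decreases to 0 is a
  supremum by monotonicity, and the maximum over separated sets is taken after applying
  the increasing function \<open>(1/n) log\<close>.
\<close>

definition topological_entropy :: "('a::metric_space \<Rightarrow> 'a) \<Rightarrow> ereal" where
  "topological_entropy T =
     (SUP \<epsilon>\<in>{0<..}. limsup (\<lambda>n.
        SUP E\<in>{E. finite E \<and> separated_set T n \<epsilon> E}. ereal (ln (real (card E)) / real n)))"

end

theory Submission
  imports Defs
begin

text \<open>
Everything is reduced to two kinds of points, both dense in the space.

The first kind are points whose orbit is \<^emph>\<open>limit periodic\<close>: for each \<open>\<eta> > 0\<close> there is a period
\<open>p\<close> such that \<open>T\<^sup>j z\<close> and \<open>T\<^sup>k z\<close> are \<open>\<eta>\<close>-close whenever \<open>j\<close> and \<open>k\<close> agree modulo \<open>p\<close>. Transitivity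
gives an orbit segment that returns close to its start, shadowing turns the periodic chain made of it
into a true orbit, and two close terms among the returns of that orbit start the next, finer chain;
the limit of this construction is limit periodic (\<open>dense_limit_periodic_orbits\<close>). Along such an orbit
Birkhoff averages converge, uniformly in the starting time, and their limit is integration against
a measure that can be written down: the orbit extends continuously to an odometer, and the measure is
the image of Lebesgue measure on \<open>[0,1)\<close> under reversal of digits (\<open>limit_periodic_distribution\<close>).
Uniformity makes this measure ergodic, and the point lies in its basin and its support
(\<open>limit_periodic_orbit_ergodic_measure\<close>). Hence the measure center is the whole space and the
basins of ergodic measures have dense union.

The second kind are generic points. An invariant measure now exists, so the failure of
unique ergodicity provides two of them; a continuous function \<open>\<phi>\<close> with different integrals then
has averages that drop infinitely often to some \<open>c\<close> along one orbit and rise infinitely often to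
some \<open>d > c\<close> along another. Shadowing a chain with a single jump shows that near every point there is
one whose orbit eventually follows a prescribed orbit, hence inherits its upper and lower limits of
averages up to an error. With a countable dense set of observables and the Baire category
theorem, generic points have, for all observables at once, the most extreme upper and lower limits
that occur on any orbit (\<open>generic_points_have_extremal_averages\<close>). So they are irregular for \<open>\<phi>\<close>
and for every observable that has an irregular point at all.

If \<open>T\<close> were not sensitive, then some ball would contain a generic and a limit-periodic point that stay
close for all times, although the averages of \<open>\<phi>\<close> oscillate along one and converge along the
other. Finally, sensitivity gives two chains from a point to itself that are far apart at some time.
Running them one after the other in both orders yields two loops of equal length, and shadowing all
concatenations of these two loops yields exponentially many separated orbits.
\<close>

section \<open>Mean values of limit-periodic sequences\<close>

text \<open>
This is uniform continuity of \<open>s\<close> for the profinite uniformity on the natural numbers; a sequence in a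
complete space has this property iff it extends continuously to some odometer.
\<close>

definition limit_periodic :: "(nat \<Rightarrow> 'a::metric_space) \<Rightarrow> bool" where
  "limit_periodic s \<longleftrightarrow>
     (\<forall>\<eta>>0. \<exists>p>0. \<forall>j k. j mod p = k mod p \<longrightarrow> dist (s j) (s k) < \<eta>)"

lemma limit_periodic_compose:
  assumes "limit_periodic s" "uniformly_continuous_on UNIV f"
  shows "limit_periodic (\<lambda>n. f (s n))"
  using assms unfolding limit_periodic_def uniformly_continuous_on_def by (metis UNIV_I)

text \<open>
A sequence that is exactly \<open>p\<close>-periodic with mean zero has \<open>p\<close>-periodic, hence bounded, partial sums,
so its averages over any window of length \<open>n\<close> are \<open>O(1/n)\<close> no matter where the window starts.
A limit-periodic sequence is a uniform limit of periodic ones. The independence of the starting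
point \<open>i\<close> is what later yields invariance and ergodicity.
\<close>

lemma limit_periodic_mean:
  fixes a :: "nat \<Rightarrow> real"
  assumes "limit_periodic a"
  obtains c where "(\<lambda>n. (\<Sum>j<n. a j) / real n) \<longlonglongrightarrow> c"
    "\<And>\<eta>. \<eta> > 0 \<Longrightarrow> \<exists>N. \<forall>n\<ge>N. \<forall>i. \<bar>(\<Sum>j<n. a (i + j)) / real n - c\<bar> < \<eta>"
proof -
  define A where "A i n = (\<Sum>j<n. a (i + j)) / real n" for i n
  have near: "\<exists>S N. \<forall>n\<ge>N. \<forall>i. \<bar>A i n - S\<bar> < \<eta>" if \<eta>: "\<eta> > 0" for \<eta>
  proof -
    obtain p where p: "p > 0" "\<And>j k. j mod p = k mod p \<Longrightarrow> dist (a j) (a k) < \<eta> / 2"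
      using assms \<eta> unfolding limit_periodic_def by (meson half_gt_zero)
    define S where "S = (\<Sum>j<p. a j) / real p"
    define g where "g j = a (j mod p) - S" for j
    define G where "G n = (\<Sum>j<n. g j)" for n
    \<comment> \<open>partial sums of a \<open>p\<close>-periodic sequence of mean zero are \<open>p\<close>-periodic\<close>
    have "G p = 0" using p(1) by (simp add: G_def g_def sum_subtractf S_def)
    then have G_shift: "G (n + p) = G n" for n
      by (induction n) (simp_all add: G_def g_def)
    have G_shifts: "G (n + k * p) = G n" for n k
    proof (induction k)
      case (Suc k)
      have "n + Suc k * p = (n + k * p) + p" by simp
      then show ?case using G_shift[of "n + k * p"] Suc by metis
    qed simp
    define C where "C = (\<Sum>j<p. \<bar>g j\<bar>)"
    have GC: "\<bar>G n\<bar> \<le> C" for n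
    proof -
      have "G n = G (n mod p)"
        using G_shifts[of "n mod p" "n div p"] by simp
      also have "\<bar>\<dots>\<bar> \<le> (\<Sum>j<n mod p. \<bar>g j\<bar>)" unfolding G_def by (rule sum_abs)
      also have "\<dots> \<le> C" unfolding C_def using p(1)
        by (intro sum_mono2) (auto simp: less_imp_le intro: less_trans)
      finally show ?thesis .
    qed
    have g_sum: "(\<Sum>j<n. g (i + j)) = G (i + n) - G i" for i n
      by (induction n) (simp_all add: G_def)
    obtain N0 :: nat where N0: "real N0 > 4 * C / \<eta>" using reals_Archimedean2 by blast
    have "\<bar>A i n - S\<bar> < \<eta>" if n: "n \<ge> Suc N0" for i n
    proof -
      have "\<bar>(\<Sum>j<n. a (i + j)) - (\<Sum>j<n. g (i + j) + S)\<bar>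
          \<le> (\<Sum>j<n. \<bar>a (i + j) - (g (i + j) + S)\<bar>)"
        unfolding sum_subtractf[symmetric] by (rule sum_abs)
      also have "\<dots> \<le> (\<Sum>j<n. \<eta> / 2)"
      proof (rule sum_mono)
        fix j
        have "dist (a (i + j)) (a ((i + j) mod p)) < \<eta> / 2" by (rule p(2)) simp
        then show "\<bar>a (i + j) - (g (i + j) + S)\<bar> \<le> \<eta> / 2" by (simp add: g_def dist_real_def)
      qed
      finally have "\<bar>(\<Sum>j<n. a (i + j)) - (\<Sum>j<n. g (i + j) + S)\<bar> \<le> real n * (\<eta> / 2)" by simp
      moreover have "(\<Sum>j<n. g (i + j) + S) = G (i + n) - G i + real n * S"
        by (simp add: sum.distrib g_sum)
      ultimately have "\<bar>(\<Sum>j<n. a (i + j)) - real n * S\<bar> \<le> real n * (\<eta> / 2) + 2 * C"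
        using GC[of "i + n"] GC[of i] by linarith
      moreover have "real n > 4 * C / \<eta>" using N0 n by linarith
      then have "2 * C < real n * (\<eta> / 2)" using \<eta> by (simp add: field_simps)
      ultimately have "\<bar>(\<Sum>j<n. a (i + j)) - real n * S\<bar> < real n * \<eta>" by linarith
      moreover have "(A i n - S) * real n = (\<Sum>j<n. a (i + j)) - real n * S"
        using n by (simp add: A_def algebra_simps)
      moreover have "real n > 0" using n by simp
      ultimately have "\<bar>A i n - S\<bar> * real n < \<eta> * real n"
        by (metis abs_mult abs_of_nat mult.commute)
      then show ?thesis using \<open>real n > 0\<close> by (simp only: mult_less_cancel_right_pos)
    qed
    then show ?thesis by blast
  qed
  have "Cauchy (A 0)"
    unfolding Cauchy_altdef2
  proof (intro allI impI)
    fix \<eta> :: real assume "\<eta> > 0"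
    then obtain S N where "\<forall>n\<ge>N. \<forall>i. \<bar>A i n - S\<bar> < \<eta> / 2" using near[of "\<eta>/2"] by auto
    then have N: "\<bar>A 0 n - S\<bar> < \<eta> / 2" if "n \<ge> N" for n using that by blast
    have "dist (A 0 n) (A 0 N) < \<eta>" if "n \<ge> N" for n
      using N[OF that] N[of N] unfolding dist_real_def by linarith
    then show "\<exists>N. \<forall>n\<ge>N. dist (A 0 n) (A 0 N) < \<eta>" by blast
  qed
  then obtain c where c: "A 0 \<longlonglongrightarrow> c" using Cauchy_convergent convergent_def by blast
  show thesis
  proof (rule that)
    show "(\<lambda>n. (\<Sum>j<n. a j) / real n) \<longlonglongrightarrow> c"
      using c by (simp add: A_def[abs_def])
  next
    fix \<eta> :: real assume \<eta>: "\<eta> > 0"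
    then obtain S N where SN: "\<And>n i. n\<ge>N \<Longrightarrow> \<bar>A i n - S\<bar> < \<eta> / 3" using near[of "\<eta>/3"] by auto
    obtain M where M: "\<And>n. n\<ge>M \<Longrightarrow> \<bar>A 0 n - c\<bar> < \<eta> / 3"
      using c \<eta> unfolding lim_sequentially dist_real_def by (meson divide_pos_pos zero_less_numeral)
    have "\<bar>A i n - c\<bar> < \<eta>" if "n \<ge> N" for i n
      using SN[OF that, of i] SN[of "max M N" 0] M[of "max M N"] by linarith
    then show "\<exists>N. \<forall>n\<ge>N. \<forall>i. \<bar>(\<Sum>j<n. a (i + j)) / real n - c\<bar> < \<eta>"
      unfolding A_def by blast
  qed
qed

section \<open>The distribution of a limit-periodic sequence\<close>

lemma compact_imp_continuous_bounded:
  fixes f :: "'a::metric_space \<Rightarrow> real"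
  assumes "compact (UNIV :: 'a set)" "continuous_on UNIV f"
  obtains B where "B > 0" "\<And>x. \<bar>f x\<bar> \<le> B"
proof -
  have "bounded (range f)"
    using compact_continuous_image[OF assms(2,1)] by (rule compact_imp_bounded)
  then show thesis unfolding bounded_pos using that by auto
qed

text \<open>
The indicator of a closed set is a decreasing limit of continuous functions of the distance to that
set, and closed sets form a generator of the Borel sets that is stable under intersection.
\<close>

lemma borel_measure_eqI_continuous:
  fixes M N :: "'a::metric_space measure"
  assumes M: "prob_space M" "sets M = sets borel" and N: "prob_space N" "sets N = sets borel"
    and eq: "\<And>f :: 'a \<Rightarrow> real. continuous_on UNIV f \<Longrightarrow> bounded (range f)
      \<Longrightarrow> (\<integral>x. f x \<partial>M) = (\<integral>x. f x \<partial>N)"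
  shows "M = N"
proof -
  interpret M: prob_space M by fact
  interpret N: prob_space N by fact
  have eq_closed: "emeasure M C = emeasure N C" if C: "closed C" for C
  proof (cases "C = {}")
    case False
    define f where "f n x = max 0 (1 - real n * infdist x C)" for n x
    have f01: "0 \<le> f n x" "f n x \<le> 1" for n x
      by (auto simp: f_def infdist_nonneg)
    have cont: "continuous_on UNIV (f n)" for n
      unfolding f_def by (intro continuous_intros)
    have lim: "(\<lambda>n. f n x) \<longlonglongrightarrow> indicator C x" for x
    proof (cases "x \<in> C")
      case True
      then show ?thesis by (simp add: f_def)
    next
      case False
      then have pos: "infdist x C > 0"
        using C \<open>C \<noteq> {}\<close> by (simp add: infdist_pos_not_in_closed)
      obtain n0 :: nat where n0: "real n0 > 1 / infdist x C" using reals_Archimedean2 by blast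
      have "f n x = 0" if "n \<ge> n0" for n
      proof -
        have "real n > 1 / infdist x C" using n0 that by linarith
        then have "real n * infdist x C > 1" using pos by (simp add: field_simps)
        then show ?thesis by (simp add: f_def)
      qed
      then have "\<forall>\<^sub>F n in sequentially. f n x = 0" by (auto simp: eventually_sequentially)
      then show ?thesis using False by (simp add: tendsto_eventually)
    qed
    have lim_int: "(\<lambda>n. \<integral>x. f n x \<partial>K) \<longlonglongrightarrow> measure K C"
      if "prob_space K" and K[measurable_cong]: "sets K = sets borel" for K
    proof -
      interpret K: prob_space K by fact
      have [measurable]: "f n \<in> borel_measurable K" for n
        using borel_measurable_continuous_onI[OF cont] by measurable
      have [measurable]: "C \<in> sets K" using C K by simp
      have "(\<lambda>n. \<integral>x. f n x \<partial>K) \<longlonglongrightarrow> (\<integral>x. indicator C x \<partial>K)"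
        by (rule integral_dominated_convergence[where w="\<lambda>_. 1"])
          (use f01 lim in \<open>auto simp: abs_le_iff order_trans[OF _ f01(1)]\<close>)
      then show ?thesis by simp
    qed
    have "bounded (range (f n))" for n
      unfolding bounded_iff using f01 by (intro exI[of _ 1]) auto
    then have "(\<lambda>n. \<integral>x. f n x \<partial>N) \<longlonglongrightarrow> measure M C"
      using lim_int[OF M] eq[OF cont] by simp
    then have "measure M C = measure N C"
      using lim_int[OF N] by (rule LIMSEQ_unique)
    then show ?thesis by (simp add: M.emeasure_eq_measure N.emeasure_eq_measure)
  qed simp
  show ?thesis
  proof (rule measure_eqI_generator_eq[where E="Collect closed" and \<Omega>=UNIV and A="\<lambda>_. UNIV"])
    show "Int_stable (Collect closed :: 'a set set)"
      by (auto simp: Int_stable_def)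
    show "sets M = sigma_sets UNIV (Collect closed)" "sets N = sigma_sets UNIV (Collect closed)"
      using M(2) N(2) by (simp_all add: borel_eq_closed)
  qed (use eq_closed M in auto)
qed

text \<open>
The value with the digits of \<open>k < b\<^sub>0 \<cdots> b\<^sub>n\<^sub>-\<^sub>1\<close> in reverse order, in the mixed radix system with bases
\<open>b\<^sub>0, \<dots>, b\<^sub>n\<^sub>-\<^sub>1\<close>. The leading digits of a real number in \<open>[0,1)\<close>, which nested intervals determine,
thereby become the residues modulo \<open>b\<^sub>0\<close>, \<open>b\<^sub>0 b\<^sub>1\<close>, \<open>\<dots>\<close>, which determine a point of the odometer.
\<close>

primrec radix_reversal :: "(nat \<Rightarrow> nat) \<Rightarrow> nat \<Rightarrow> nat \<Rightarrow> nat" where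
  "radix_reversal b 0 k = k"
| "radix_reversal b (Suc n) k =
     radix_reversal b n (k div b n) + (\<Prod>i<n. b i) * (k mod b n)"

text \<open>
Digit reversal permutes the numbers below \<open>b\<^sub>0 \<cdots> b\<^sub>n\<^sub>-\<^sub>1\<close>. By induction: split \<open>k\<close> into its last digit \<open>j\<close>
and the rest \<open>i\<close>; for fixed \<open>j\<close> the sum over \<open>i\<close> is a shifted instance of the previous stage.
\<close>

lemma sum_radix_reversal:
  fixes h :: "nat \<Rightarrow> real"
  assumes "\<And>i. b i > 0"
  shows "(\<Sum>k<(\<Prod>i<n. b i). h (radix_reversal b n k)) = (\<Sum>k<(\<Prod>i<n. b i). h k)"
proof (induction n arbitrary: h)
  case (Suc n)
  let ?p = "\<Prod>i<n. b i"
  let ?q = "b n"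
  have split: "(\<Sum>k<m * l. f k) = (\<Sum>i<m. \<Sum>j<l. f (i * l + j))" for f :: "nat \<Rightarrow> real" and m l
  proof -
    have "(\<Sum>j = i * l..<i * l + l. f j) = (\<Sum>j<l. f (i * l + j))" for i
      using sum.shift_bounds_nat_ivl[of f 0 "i * l" l]
      by (simp add: atLeast0LessThan add.commute)
    then show ?thesis by (simp add: sum.nat_group[symmetric])
  qed
  have "(\<Sum>k<?p * ?q. h (radix_reversal b (Suc n) k))
      = (\<Sum>i<?p. \<Sum>j<?q. h (radix_reversal b (Suc n) (i * ?q + j)))"
    by (rule split)
  also have "\<dots> = (\<Sum>i<?p. \<Sum>j<?q. h (radix_reversal b n i + ?p * j))"
    by (intro sum.cong refl) (use assms[of n] in simp)
  also have "\<dots> = (\<Sum>j<?q. \<Sum>i<?p. h (radix_reversal b n i + ?p * j))"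
    by (rule sum.swap)
  also have "\<dots> = (\<Sum>j<?q. \<Sum>i<?p. h (i + ?p * j))"
    by (intro sum.cong refl Suc.IH)
  also have "\<dots> = (\<Sum>k<?q * ?p. h k)"
    by (simp add: split algebra_simps)
  finally show ?case by (simp add: mult.commute)
qed simp

lemma integral_uniform_floor:
  fixes g :: "nat \<Rightarrow> real"
  assumes "p > 0"
  shows "(\<integral>u. g (nat \<lfloor>u * real p\<rfloor>) \<partial>uniform_measure lborel {0..<1}) = (\<Sum>k<p. g k) / real p"
proof -
  let ?U = "uniform_measure lborel {0..<1::real}"
  let ?I = "\<lambda>k. {real k / real p..<real (Suc k) / real p}"
  interpret prob_space ?U by (rule prob_space_uniform_measure) auto
  have I_iff: "u \<in> ?I k \<longleftrightarrow> nat \<lfloor>u * real p\<rfloor> = k" if "0 \<le> u" for u k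
  proof -
    have "u \<in> ?I k \<longleftrightarrow> real k \<le> u * real p \<and> u * real p < real k + 1"
      using assms by (simp add: field_simps)
    also have "\<dots> \<longleftrightarrow> \<lfloor>u * real p\<rfloor> = int k"
      by (simp add: floor_eq_iff)
    also have "\<dots> \<longleftrightarrow> nat \<lfloor>u * real p\<rfloor> = k"
      using that by (auto simp: nat_eq_iff)
    finally show ?thesis .
  qed
  have "AE u in ?U. g (nat \<lfloor>u * real p\<rfloor>) = (\<Sum>k<p. g k * indicator (?I k) u)"
  proof (rule AE_uniform_measureI)
    show "AE u in lborel. u \<in> {0..<1} \<longrightarrow>
        g (nat \<lfloor>u * real p\<rfloor>) = (\<Sum>k<p. g k * indicator (?I k) u)"
    proof (intro AE_I2 impI)
      fix u :: real assume u: "u \<in> {0..<1}"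
      let ?k = "nat \<lfloor>u * real p\<rfloor>"
      have "u * real p < real p" using u assms by simp
      then have "?k < p" using u by (simp add: nat_less_iff floor_less_iff)
      have "(\<Sum>k<p. g k * indicator (?I k) u) = (\<Sum>k<p. if k = ?k then g k else 0)"
        using u I_iff[of u] by (intro sum.cong) (auto simp: indicator_def)
      also have "\<dots> = g ?k" using \<open>?k < p\<close> by simp
      finally show "g ?k = (\<Sum>k<p. g k * indicator (?I k) u)" by simp
    qed
  qed simp
  then have "(\<integral>u. g (nat \<lfloor>u * real p\<rfloor>) \<partial>?U) = (\<integral>u. (\<Sum>k<p. g k * indicator (?I k) u) \<partial>?U)"
    by (intro integral_cong_AE) measurable
  also have "\<dots> = (\<Sum>k<p. g k * measure ?U (?I k))"
  proof (subst Bochner_Integration.integral_sum)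
    show "integrable ?U (\<lambda>u. g k * indicator (?I k) u)" for k
      by (intro integrable_mult_right integrable_real_indicator) (auto simp del: emeasure_uniform_measure simp: emeasure_eq_measure)
  qed simp
  also have "\<dots> = (\<Sum>k<p. g k * (1 / real p))"
  proof (intro sum.cong refl)
    fix k assume k: "k \<in> {..<p}"
    have "?I k \<subseteq> {0..<1}" using k assms by (auto simp: field_simps)
    then have "{0..<1} \<inter> ?I k = ?I k" by blast
    then have "measure ?U (?I k) = 1 / real p"
      using assms by (simp add: field_simps)
    then show "g k * measure ?U (?I k) = g k * (1 / real p)" by simp
  qed
  also have "\<dots> = (\<Sum>k<p. g k) / real p" by (simp add: sum_divide_distrib)
  finally show ?thesis .
qed

lemma geometric_steps_limit:
  fixes f :: "nat \<Rightarrow> 'a::metric_space"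
  assumes "compact (UNIV :: 'a set)" and step: "\<And>n. dist (f (Suc n)) (f n) \<le> (1 / 2) ^ n"
  obtains l where "f \<longlonglongrightarrow> l"
proof -
  have d: "dist (f (n + m)) (f n) \<le> 2 * (1 / 2) ^ n - 2 * (1 / 2) ^ (n + m)" for n m
  proof (induction m)
    case (Suc m)
    have "dist (f (n + Suc m)) (f n) \<le> dist (f (Suc (n + m))) (f (n + m)) + dist (f (n + m)) (f n)"
      by (simp add: dist_triangle)
    also have "\<dots> \<le> (1 / 2) ^ (n + m) + (2 * (1 / 2) ^ n - 2 * (1 / 2) ^ (n + m))"
      using step[of "n + m"] Suc by linarith
    also have "\<dots> = 2 * (1 / 2) ^ n - 2 * (1 / 2) ^ (n + Suc m)" by simp
    finally show ?case .
  qed simp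
  have "Cauchy f"
    unfolding Cauchy_altdef2
  proof (intro allI impI)
    fix e :: real assume "e > 0"
    then obtain n where n: "(1 / 2) ^ n < e / 2" using real_arch_pow_inv[of "e / 2" "1/2"] by auto
    have "dist (f m) (f n) < e" if "m \<ge> n" for m
    proof -
      have "dist (f m) (f n) \<le> 2 * (1 / 2) ^ n - 2 * (1 / 2) ^ m"
        using d[of n "m - n"] that by simp
      moreover have "(1 / 2 :: real) ^ m > 0" by simp
      ultimately show ?thesis using n by linarith
    qed
    then show "\<exists>n. \<forall>m\<ge>n. dist (f m) (f n) < e" by blast
  qed
  then show thesis
    using compact_imp_complete[OF assms(1)] that unfolding complete_def by blast
qed

text \<open>
Choose periods \<open>p\<^sub>n\<close>, each dividing the next, that work for errors decreasing geometrically. Map \<open>u \<in> [0,1)\<close> to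
\<open>s (\<sigma>\<^sub>n \<lfloor>u p\<^sub>n\<rfloor>)\<close> with \<open>\<sigma>\<^sub>n\<close> the digit reversal. Passing from \<open>n\<close> to \<open>n + 1\<close> preserves the residue
modulo \<open>p\<^sub>n\<close>, so these step functions converge uniformly, and the integral of an observable along the
\<open>n\<close>-th one is exactly its average over the first \<open>p\<^sub>n\<close> terms of \<open>s\<close>. The image of the uniform
distribution under the limit is the required measure.
\<close>

lemma limit_periodic_distribution:
  fixes s :: "nat \<Rightarrow> 'a::metric_space"
  assumes comp: "compact (UNIV :: 'a set)" and s: "limit_periodic s"
  obtains \<mu> where "sets \<mu> = sets borel" "prob_space \<mu>"
    "\<And>f. continuous_on UNIV f \<Longrightarrow> (\<lambda>n. (\<Sum>j<n. f (s j)) / real n) \<longlonglongrightarrow> (\<integral>x. f x \<partial>\<mu>)"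
proof -
  have "\<exists>p>0. \<forall>j k. j mod p = k mod p \<longrightarrow> dist (s j) (s k) < (1 / 2) ^ n" for n
    using s unfolding limit_periodic_def by simp
  then obtain P where P: "\<And>n. P n > 0"
    "\<And>n j k. j mod P n = k mod P n \<Longrightarrow> dist (s j) (s k) < (1 / 2) ^ n"
    by metis
  \<comment> \<open>the factor 2 keeps the residue condition and forces the products \<open>p n\<close> to tend to infinity\<close>
  define b where "b n = 2 * P n" for n
  define p where "p n = (\<Prod>i<n. b i)" for n
  have b: "b n > 0" "b n \<ge> 2" for n using P(1)[of n] by (auto simp: b_def)
  have p0: "p n > 0" for n using b(1) by (simp add: p_def)
  have p_Suc: "p (Suc n) = p n * b n" for n by (simp add: p_def mult.commute)
  have p_mod: "dist (s j) (s k) < (1 / 2) ^ n" if "j mod p (Suc n) = k mod p (Suc n)" for n j k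
  proof (rule P(2))
    have "P n dvd p (Suc n)" by (simp add: p_Suc b_def)
    then show "j mod P n = k mod P n" using that by (metis mod_mod_cancel)
  qed
  define f where "f n u = s (radix_reversal b (Suc n) (nat \<lfloor>u * real (p (Suc n))\<rfloor>))" for n u
  have step: "dist (f (Suc n) u) (f n u) \<le> (1 / 2) ^ n" for n u
  proof -
    let ?m = "p (Suc n)" and ?q = "b (Suc n)"
    have "\<lfloor>u * real ?m\<rfloor> = \<lfloor>u * real (?m * ?q) / real_of_int (int ?q)\<rfloor>"
      using b(1)[of "Suc n"] by simp
    also have "\<dots> = \<lfloor>u * real (?m * ?q)\<rfloor> div int ?q" by (rule floor_divide_real_eq_div) simp
    finally have "nat \<lfloor>u * real ?m\<rfloor> = nat \<lfloor>u * real (?m * ?q)\<rfloor> div ?q"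
      using b(1)[of "Suc n"] by (simp add: nat_div_distrib')
    then have "radix_reversal b (Suc (Suc n)) (nat \<lfloor>u * real (p (Suc (Suc n)))\<rfloor>) mod ?m
        = radix_reversal b (Suc n) (nat \<lfloor>u * real ?m\<rfloor>) mod ?m"
      by (simp only: radix_reversal.simps(2)[of b "Suc n"] p_Suc[of "Suc n"]
          p_def[of "Suc n", symmetric] mod_mult_self2)
    then show ?thesis unfolding f_def using p_mod by (simp add: less_imp_le)
  qed
  have "\<exists>l. (\<lambda>n. f n u) \<longlonglongrightarrow> l" for u
    using geometric_steps_limit[OF comp, of "\<lambda>n. f n u"] step by metis
  then obtain F where F: "\<And>u. (\<lambda>n. f n u) \<longlonglongrightarrow> F u" by metis
  let ?U = "uniform_measure lborel {0..<1::real}"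
  interpret U: prob_space ?U by (rule prob_space_uniform_measure) auto
  have f_meas[measurable]: "f n \<in> borel_measurable ?U" for n
    unfolding f_def by measurable
  have F_meas[measurable]: "F \<in> borel_measurable ?U"
    by (rule borel_measurable_LIMSEQ_metric[where f=f]) (use F in auto)
  have p_ge: "n \<le> p n" for n
  proof -
    have "2 ^ n \<le> p n"
    proof (induction n)
      case (Suc n)
      then have "2 ^ n * 2 \<le> p n * b n" using b(2)[of n] by (rule mult_le_mono)
      then show ?case by (simp add: p_Suc)
    qed (simp add: p_def)
    then show ?thesis using less_exp[of n] by linarith
  qed
  show thesis
  proof (rule that)
    show "prob_space (distr ?U borel F)" by (rule U.prob_space_distr) simp
    show "(\<lambda>n. (\<Sum>j<n. \<phi> (s j)) / real n) \<longlonglongrightarrow> (\<integral>x. \<phi> x \<partial>distr ?U borel F)"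
      if cont: "continuous_on UNIV \<phi>" for \<phi> :: "'a \<Rightarrow> real"
    proof -
      have [measurable]: "\<phi> \<in> borel_measurable borel"
        using cont by (rule borel_measurable_continuous_onI)
      obtain B where B: "\<And>x. \<bar>\<phi> x\<bar> \<le> B"
        using compact_imp_continuous_bounded[OF comp cont] by blast
      have "(\<lambda>n. \<integral>u. \<phi> (f n u) \<partial>?U) \<longlonglongrightarrow> (\<integral>u. \<phi> (F u) \<partial>?U)"
      proof (rule integral_dominated_convergence[where w="\<lambda>_. B"])
        show "AE u in ?U. (\<lambda>n. \<phi> (f n u)) \<longlonglongrightarrow> \<phi> (F u)"
          using continuous_on_tendsto_compose[OF cont F] by simp
      qed (use B in auto)
      moreover have "(\<integral>u. \<phi> (f n u) \<partial>?U) = (\<Sum>j<p (Suc n). \<phi> (s j)) / real (p (Suc n))" for n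
        using integral_uniform_floor[OF p0[of "Suc n"], of "\<lambda>k. \<phi> (s (radix_reversal b (Suc n) k))"]
          sum_radix_reversal[where b=b, OF b(1), where h="\<lambda>k. \<phi> (s k)" and n="Suc n"]
        unfolding f_def p_def by (simp only:)
      ultimately have
        "(\<lambda>n. (\<Sum>j<p (Suc n). \<phi> (s j)) / real (p (Suc n))) \<longlonglongrightarrow> (\<integral>x. \<phi> x \<partial>distr ?U borel F)"
        by (simp add: integral_distr)
      moreover have "limit_periodic (\<lambda>n. \<phi> (s n))"
        using s compact_uniformly_continuous[OF cont comp] by (rule limit_periodic_compose)
      then obtain c where lim: "(\<lambda>n. (\<Sum>j<n. \<phi> (s j)) / real n) \<longlonglongrightarrow> c"
        using limit_periodic_mean by blast
      moreover have "filterlim (\<lambda>n. p (Suc n)) at_top sequentially"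
        by (rule filterlim_at_top_mono[OF filterlim_Suc])
          (use p_ge in simp)
      then have "(\<lambda>n. (\<Sum>j<p (Suc n). \<phi> (s j)) / real (p (Suc n))) \<longlonglongrightarrow> c"
        by (rule filterlim_compose[OF lim])
      ultimately show ?thesis using LIMSEQ_unique by blast
    qed
  qed simp
qed

section \<open>Density of limit-periodic orbits\<close>

text \<open>
Sequences indexed from 0 are convenient for concatenating orbit segments; a shift by one
step moves a chain to the indices from 1 that the definition of shadowing constrains.
\<close>

lemma shadowing_from_0:
  assumes "shadowing_property T" "e > 0"
  obtains d where "d > 0"
    "\<And>x. (\<And>n. dist (T (x n)) (x (Suc n)) < d) \<Longrightarrow> \<exists>y. \<forall>n. dist ((T ^^ n) y) (x n) < e"
proof -
  obtain d where d: "d > 0" "\<And>x. pseudo_orbit T d x \<Longrightarrow> shadowed T e x"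
    using assms unfolding shadowing_property_def by blast
  show thesis
  proof (rule that[OF d(1)])
    fix x assume x: "\<And>n. dist (T (x n)) (x (Suc n)) < d"
    have "pseudo_orbit T d (\<lambda>n. x (n - 1))"
      unfolding pseudo_orbit_def
    proof (intro allI impI)
      fix n :: nat assume "n \<ge> 1"
      then show "dist (T (x (n - 1))) (x (Suc n - 1)) < d"
        using x[of "n - 1"] by simp
    qed
    then obtain y where y: "\<And>n. n \<ge> 1 \<Longrightarrow> dist ((T ^^ n) y) (x (n - 1)) < e"
      using d(2) unfolding shadowed_def by blast
    have "dist ((T ^^ n) (T y)) (x n) < e" for n
      using y[of "Suc n"] by (simp add: funpow_swap1)
    then show "\<exists>y. \<forall>n. dist ((T ^^ n) y) (x n) < e" by blast
  qed
qed

lemma continuous_on_funpow: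
  fixes T :: "'a::topological_space \<Rightarrow> 'a"
  assumes "continuous_on UNIV T"
  shows "continuous_on UNIV (T ^^ n)"
proof (induction n)
  case (Suc n)
  then show ?case
    using continuous_on_compose2[OF assms Suc] by (simp add: o_def)
qed (simp add: continuous_on_id)

lemma compact_two_close_terms:
  fixes s :: "nat \<Rightarrow> 'a::metric_space"
  assumes "compact (UNIV :: 'a set)" "d > 0"
  obtains i k where "i < k" "dist (s i) (s k) < d"
proof -
  obtain l r where r: "strict_mono r" "(s \<circ> r) \<longlonglongrightarrow> l"
    using assms(1) unfolding compact_def by (metis UNIV_I)
  have "Cauchy (s \<circ> r)"
    using r(2) by (simp add: LIMSEQ_imp_Cauchy)
  then obtain N where "\<And>m n. m \<ge> N \<Longrightarrow> n \<ge> N \<Longrightarrow> dist ((s \<circ> r) m) ((s \<circ> r) n) < d"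
    using assms(2) unfolding Cauchy_def by blast
  from this[of N "Suc N"] have "dist (s (r N)) (s (r (Suc N))) < d" by simp
  moreover have "r N < r (Suc N)" using r(1) by (simp add: strict_mono_Suc_iff)
  ultimately show thesis using that by blast
qed

lemma periodic_chain_is_shadowed:
  assumes "dist ((T ^^ p) v) v < d" "p > 0"
    and "\<And>x. (\<And>n. dist (T (x n)) (x (Suc n)) < d) \<Longrightarrow> \<exists>y. \<forall>n. dist ((T ^^ n) y) (x n) < e"
  obtains w where "\<And>j. dist ((T ^^ j) w) ((T ^^ (j mod p)) v) < e"
proof -
  have "d > 0" using assms(1) zero_le_dist le_less_trans by blast
  have "dist (T ((T ^^ (j mod p)) v)) ((T ^^ (Suc j mod p)) v) < d" for j
  proof (cases "Suc (j mod p) = p")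
    case True
    then have "T ((T ^^ (j mod p)) v) = (T ^^ p) v"
      by (metis funpow.simps(2) o_apply)
    then show ?thesis using assms(1) True by (simp add: mod_Suc)
  next
    case False
    then show ?thesis using \<open>d > 0\<close> by (simp add: mod_Suc)
  qed
  then show thesis using assms(3)[of "\<lambda>j. (T ^^ (j mod p)) v"] that by blast
qed

text \<open>
The orbit is built in stages \<open>(p\<^sub>n, v\<^sub>n)\<close>, where \<open>v\<^sub>n\<close> almost returns to itself after \<open>p\<^sub>n\<close> steps. Shadow the
\<open>p\<^sub>n\<close>-periodic repetition of \<open>v\<^sub>n, \<dots>, T\<^bsup>p\<^sub>n - 1\<^esup> v\<^sub>n\<close> by the orbit of some \<open>w\<close>. By compactness two of the points
\<open>T\<^bsup>p\<^sub>n i\<^esup> w\<close> are as close as desired; the earlier one becomes \<open>v\<^sub>n\<^sub>+\<^sub>1\<close> and the time between them \<open>p\<^sub>n\<^sub>+\<^sub>1\<close>.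
Starting at a multiple of \<open>p\<^sub>n\<close> keeps the phase modulo \<open>p\<^sub>n\<close>, so the orbit of \<open>v\<^sub>n\<^sub>+\<^sub>1\<close> still follows the
periodic repetition of stage \<open>n\<close>. The errors form a geometric series, and a limit point \<open>z\<close> of
the \<open>v\<^sub>n\<close> follows the periodic pattern of every stage.
\<close>

lemma dense_limit_periodic_orbits:
  fixes T :: "'a::metric_space \<Rightarrow> 'a"
  assumes comp: "compact (UNIV :: 'a set)" and cont: "continuous_on UNIV T"
    and trans: "top_transitive T" and shad: "shadowing_property T" and e: "e > 0"
  obtains z where "dist x z < e" "limit_periodic (\<lambda>n. (T ^^ n) z)"
proof -
  have "\<exists>d>0. \<forall>x. (\<forall>n. dist (T (x n)) (x (Suc n)) < d) \<longrightarrow>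
      (\<exists>y. \<forall>n. dist ((T ^^ n) y) (x n) < e / 2 ^ (k + 2))" for k :: nat
    using shadowing_from_0[OF shad, of "e / 2 ^ (k + 2)"] e
    by (metis divide_pos_pos zero_less_numeral zero_less_power)
  then obtain d :: "nat \<Rightarrow> real" where d0: "\<And>k. d k > 0"
    and d: "\<And>k x. (\<And>n. dist (T (x n)) (x (Suc n)) < d k) \<Longrightarrow>
      \<exists>y. \<forall>n. dist ((T ^^ n) y) (x n) < e / 2 ^ (k + 2)"
    by metis
  define P where "P = (\<lambda>n (p, v). p > 0 \<and> dist ((T ^^ p) v) v < d n
      \<and> (n = 0 \<longrightarrow> dist x v < e / 2))"
  define Q where "Q = (\<lambda>n (p, v) (p', v'). p dvd p' \<and>
      (\<forall>j. dist ((T ^^ j) v') ((T ^^ (j mod p)) v) < e / 2 ^ (n + 2)))"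
  have "\<exists>f. \<forall>n. P n (f n) \<and> Q n (f n) (f (Suc n))"
  proof (rule dependent_nat_choice)
    \<comment> \<open>the radius ensures that a point and its return in \<open>?U\<close> are \<open>d 0\<close>-close\<close>
    let ?U = "ball x (min (e / 2) (d 0 / 2))"
    have "open ?U" "?U \<noteq> {}" using e d0[of 0] by auto
    then obtain n where n: "n \<ge> 1" "?U \<inter> (T ^^ n) -` ?U \<noteq> {}"
      using trans unfolding top_transitive_def by meson
    then obtain u where u: "u \<in> ?U" "(T ^^ n) u \<in> ?U" by blast
    have "dist ((T ^^ n) u) u < d 0"
      using u dist_triangle_half_r[of x "(T ^^ n) u" "d 0" u] by auto
    then have "P 0 (n, u)" using n u by (auto simp: P_def)
    then show "\<exists>a. P 0 a" by blast
  next
    fix a n assume a: "P n a"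
    obtain p v where [simp]: "a = (p, v)" by (cases a)
    have p: "p > 0" "dist ((T ^^ p) v) v < d n" using a by (auto simp: P_def)
    from periodic_chain_is_shadowed[OF p(2,1) d]
    obtain w where w: "\<And>j. dist ((T ^^ j) w) ((T ^^ (j mod p)) v) < e / 2 ^ (n + 2)" by blast
    obtain i k where ik: "i < k" "dist ((T ^^ (p * i)) w) ((T ^^ (p * k)) w) < d (Suc n)"
      using compact_two_close_terms[OF comp d0[of "Suc n"], of "\<lambda>i. (T ^^ (p * i)) w"] by blast
    let ?v = "(T ^^ (p * i)) w"
    let ?p = "p * (k - i)"
    have "?p + p * i = p * k" using ik(1) by (metis add.commute distrib_left le_add_diff_inverse2 less_imp_le)
    then have "(T ^^ ?p) ?v = (T ^^ (p * k)) w" by (metis comp_apply funpow_add)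
    then have "P (Suc n) (?p, ?v)" using ik p by (auto simp: P_def dist_commute)
    moreover have "dist ((T ^^ j) ?v) ((T ^^ (j mod p)) v) < e / 2 ^ (n + 2)" for j
      using w[of "j + p * i"] by (simp add: funpow_add)
    then have "Q n a (?p, ?v)" by (simp add: Q_def)
    ultimately show "\<exists>b. P (Suc n) b \<and> Q n a b" by blast
  qed
  then obtain f where f: "\<And>n. P n (f n)" "\<And>n. Q n (f n) (f (Suc n))" by blast
  define p where "p n = fst (f n)" for n
  define v where "v n = snd (f n)" for n
  have f_eq: "f n = (p n, v n)" for n by (simp add: p_def v_def)
  have p0: "p n > 0" for n using f(1)[of n] by (simp add: P_def f_eq)
  have v0: "dist x (v 0) < e / 2" using f(1)[of 0] by (simp add: P_def f_eq)
  have pdvd: "p n dvd p (Suc n)" for n using f(2)[of n] by (simp add: Q_def f_eq)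
  have pdvd': "p n dvd p (n + m)" for n m
    by (induction m) (auto intro: dvd_trans pdvd)
  have step: "dist ((T ^^ j) (v (Suc n))) ((T ^^ (j mod p n)) (v n)) < e / 2 ^ (n + 2)" for n j
    using f(2)[of n] by (simp add: Q_def f_eq)
  \<comment> \<open>the errors \<open>e / 2 ^ (k + 2)\<close> of the stages \<open>n, \<dots>, n + m - 1\<close> add up; their total stays below
    \<open>e / 2 ^ (n + 1)\<close>\<close>
  have tele: "dist ((T ^^ j) (v (n + m))) ((T ^^ (j mod p n)) (v n))
      \<le> e / 2 ^ (n + 1) - e / 2 ^ (n + m + 1)" if "m > 0" for n m j
    using that
  proof (induction m arbitrary: j)
    case (Suc m)
    show ?case
    proof (cases "m = 0")
      case True
      have "dist ((T ^^ j) (v (Suc n))) ((T ^^ (j mod p n)) (v n)) \<le> e / 2 ^ (n + 2)"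
        using step[of j n] by simp
      also have "\<dots> = e / 2 ^ (n + 1) - e / 2 ^ (n + Suc m + 1)" using True by (simp add: field_simps)
      finally show ?thesis using True by simp
    next
      case False
      have "j mod p (n + m) mod p n = j mod p n"
        using pdvd' by (rule mod_mod_cancel)
      then have "dist ((T ^^ (j mod p (n + m))) (v (n + m))) ((T ^^ (j mod p n)) (v n))
          \<le> e / 2 ^ (n + 1) - e / 2 ^ (n + m + 1)"
        using Suc.IH[of "j mod p (n + m)"] False by simp
      moreover have "dist ((T ^^ j) (v (n + Suc m))) ((T ^^ (j mod p (n + m))) (v (n + m)))
          < e / 2 ^ (n + m + 2)"
        using step[of j "n + m"] by simp
      moreover have "e / 2 ^ (n + m + 1) = 2 * (e / 2 ^ (n + m + 2))"
        "e / 2 ^ (n + Suc m + 1) = e / 2 ^ (n + m + 2)" by simp_all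
      ultimately show ?thesis
        using dist_triangle[of "(T ^^ j) (v (n + Suc m))" "(T ^^ (j mod p n)) (v n)"
            "(T ^^ (j mod p (n + m))) (v (n + m))"] by linarith
    qed
  qed simp
  obtain z r where r: "strict_mono r" "(v \<circ> r) \<longlonglongrightarrow> z"
    using comp unfolding compact_def by (metis UNIV_I)
  have z: "dist ((T ^^ j) z) ((T ^^ (j mod p n)) (v n)) \<le> e / 2 ^ (n + 1)" for j n
  proof (rule tendsto_upperbound)
    have "(\<lambda>k. (T ^^ j) ((v \<circ> r) k)) \<longlonglongrightarrow> (T ^^ j) z"
      using continuous_on_tendsto_compose[OF continuous_on_funpow[OF cont] r(2)] by simp
    then show "(\<lambda>k. dist ((T ^^ j) ((v \<circ> r) k)) ((T ^^ (j mod p n)) (v n)))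
        \<longlonglongrightarrow> dist ((T ^^ j) z) ((T ^^ (j mod p n)) (v n))"
      by (intro tendsto_intros)
    show "\<forall>\<^sub>F k in sequentially. dist ((T ^^ j) ((v \<circ> r) k)) ((T ^^ (j mod p n)) (v n))
        \<le> e / 2 ^ (n + 1)"
      using eventually_gt_at_top[of n]
    proof eventually_elim
      case (elim k)
      then have "n < r k" using r(1) by (meson less_le_trans seq_suble)
      then have "dist ((T ^^ j) (v (r k))) ((T ^^ (j mod p n)) (v n))
          \<le> e / 2 ^ (n + 1) - e / 2 ^ (r k + 1)"
        using tele[of "r k - n" j n] by simp
      moreover have "e / 2 ^ (r k + 1) > 0" using e by simp
      ultimately show ?case by simp
    qed
  qed simp
  show thesis
  proof (rule that)
    have "dist z (v 0) \<le> e / 2" using z[of 0 0] by simp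
    then show "dist x z < e" using v0 dist_triangle2[of x z "v 0"] by linarith
    show "limit_periodic (\<lambda>n. (T ^^ n) z)"
      unfolding limit_periodic_def
    proof (intro allI impI)
      fix \<eta> :: real assume "\<eta> > 0"
      then have "\<eta> / e > 0" using e by simp
      then obtain n where "(1/2) ^ n < \<eta> / e"
        using real_arch_pow_inv[of "\<eta> / e" "1/2"] by auto
      then have n: "e / 2 ^ n < \<eta>" using e by (simp add: field_simps power_one_over)
      have "dist ((T ^^ j) z) ((T ^^ k) z) < \<eta>" if "j mod p n = k mod p n" for j k
      proof -
        have "dist ((T ^^ j) z) ((T ^^ k) z) \<le> e / 2 ^ (n + 1) + e / 2 ^ (n + 1)"
          using z[of j n] z[of k n] that
            dist_triangle2[of "(T ^^ j) z" "(T ^^ k) z" "(T ^^ (j mod p n)) (v n)"] by simp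
        also have "\<dots> = e / 2 ^ n" by (simp add: field_simps)
        finally show ?thesis using n by simp
      qed
      then show "\<exists>p>0. \<forall>j k. j mod p = k mod p \<longrightarrow> dist ((T ^^ j) z) ((T ^^ k) z) < \<eta>"
        using p0 by blast
    qed
  qed
qed

section \<open>Ergodic measures on limit-periodic orbits\<close>

lemma continuous_on_birkhoff_average:
  assumes "continuous_on UNIV T" "continuous_on UNIV \<phi>"
  shows "continuous_on UNIV (\<lambda>x. birkhoff_average T \<phi> x n)"
  unfolding birkhoff_average_def divide_inverse
  by (intro continuous_on_mult continuous_on_sum continuous_on_const
      continuous_on_compose2[OF assms(2) continuous_on_funpow[OF assms(1)]]) auto

lemma abs_birkhoff_average_le:
  assumes "\<And>x. \<bar>\<phi> x\<bar> \<le> B"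
  shows "\<bar>birkhoff_average T \<phi> x n\<bar> \<le> B"
proof (cases "n = 0")
  case True
  then show ?thesis using assms[of x] by (simp add: birkhoff_average_def)
next
  case False
  have "\<bar>\<Sum>j<n. \<phi> ((T ^^ j) x)\<bar> \<le> (\<Sum>j<n. B)"
    by (rule order_trans[OF sum_abs sum_mono]) (use assms in auto)
  then show ?thesis using False by (simp add: birkhoff_average_def abs_divide field_simps)
qed

lemma birkhoff_average_close:
  assumes "\<And>j. \<bar>\<phi> ((T ^^ j) x) - \<psi> ((T ^^ j) y)\<bar> \<le> \<eta>" "0 \<le> \<eta>"
  shows "\<bar>birkhoff_average T \<phi> x n - birkhoff_average T \<psi> y n\<bar> \<le> \<eta>"
proof (cases "n = 0")
  case True
  then show ?thesis using assms(2) by (simp add: birkhoff_average_def)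
next
  case False
  have "\<bar>\<Sum>j<n. \<phi> ((T ^^ j) x) - \<psi> ((T ^^ j) y)\<bar> \<le> (\<Sum>j<n. \<eta>)"
    by (rule order_trans[OF sum_abs sum_mono]) (use assms in auto)
  then show ?thesis using False
    by (simp add: birkhoff_average_def abs_divide field_simps diff_divide_distrib[symmetric] sum_subtractf)
qed

lemma integral_birkhoff_average:
  assumes comp: "compact (UNIV :: 'a::metric_space set)" and T: "continuous_on UNIV (T :: 'a \<Rightarrow> 'a)"
    and \<mu>: "\<mu> \<in> invariant_measures T" and \<phi>: "continuous_on UNIV \<phi>" and n: "n > 0"
  shows "(\<integral>x. birkhoff_average T \<phi> x n \<partial>\<mu>) = (\<integral>x. \<phi> x \<partial>\<mu>)"
proof -
  have [measurable_cong]: "sets \<mu> = sets borel" and inv: "distr \<mu> borel T = \<mu>"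
    using \<mu> by (auto simp: invariant_measures_def)
  interpret prob_space \<mu> using \<mu> by (auto simp: invariant_measures_def)
  have Tm: "(T ^^ j) \<in> borel_measurable borel" for j
    by (rule borel_measurable_continuous_onI[OF continuous_on_funpow[OF T]])
  note Tm[measurable]
  have [measurable]: "T \<in> borel_measurable borel" using Tm[of 1] by simp
  have [measurable]: "\<phi> \<in> borel_measurable borel"
    using \<phi> by (rule borel_measurable_continuous_onI)
  obtain B where B: "\<And>x. \<bar>\<phi> x\<bar> \<le> B"
    using compact_imp_continuous_bounded[OF comp \<phi>] by blast
  have int: "integrable \<mu> (\<lambda>x. \<phi> ((T ^^ j) x))" for j
    by (rule integrable_const_bound[where B=B]) (use B in auto)
  have eq: "(\<integral>x. \<phi> ((T ^^ j) x) \<partial>\<mu>) = (\<integral>x. \<phi> x \<partial>\<mu>)" for j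
  proof (induction j)
    case (Suc j)
    have "(\<integral>x. \<phi> ((T ^^ Suc j) x) \<partial>\<mu>) = (\<integral>x. \<phi> ((T ^^ j) (T x)) \<partial>\<mu>)"
      by (simp add: funpow_swap1)
    also have "\<dots> = (\<integral>x. \<phi> ((T ^^ j) x) \<partial>distr \<mu> borel T)"
      by (rule integral_distr[symmetric]) measurable
    also have "\<dots> = (\<integral>x. \<phi> x \<partial>\<mu>)" using Suc inv by simp
    finally show ?case .
  qed simp
  have "(\<integral>x. birkhoff_average T \<phi> x n \<partial>\<mu>) = (\<Sum>j<n. (\<integral>x. \<phi> ((T ^^ j) x) \<partial>\<mu>)) / real n"
    unfolding birkhoff_average_def using int by (simp add: Bochner_Integration.integral_sum)
  then show ?thesis using n by (simp add: eq)
qed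

text \<open>
Take for \<open>\<mu>\<close> the distribution of the orbit of \<open>z\<close>. Shifting the orbit does not change its averages, so
\<open>\<mu>\<close> is invariant. For ergodicity, let \<open>A\<close> be an invariant set of positive measure and \<open>\<nu>\<close> the
measure \<open>\<mu>\<close> conditioned on \<open>A\<close>. Averages over long windows along the orbit of \<open>z\<close> are close to
\<open>\<integral>\<phi> d\<mu>\<close> from every starting time. This is a closed condition on points that holds on the orbit,
so it holds at \<open>\<mu>\<close>-almost every point, and thus at \<open>\<nu>\<close>-almost every point. Integrating against the invariant measure \<open>\<nu>\<close> gives \<open>\<integral>\<phi> d\<nu> = \<integral>\<phi> d\<mu>\<close>,
so \<open>\<nu> = \<mu>\<close> and \<open>A\<close> has full measure. Finally \<open>z\<close> is in the support because its orbit
visits each neighbourhood of \<open>z\<close> at all multiples of some period.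
\<close>

lemma limit_periodic_orbit_ergodic_measure:
  fixes T :: "'a::metric_space \<Rightarrow> 'a"
  assumes comp: "compact (UNIV :: 'a set)" and T: "continuous_on UNIV T"
    and z: "limit_periodic (\<lambda>n. (T ^^ n) z)"
  obtains \<mu> where "\<mu> \<in> ergodic_measures T" "z \<in> basin T \<mu>" "z \<in> measure_support \<mu>"
proof -
  obtain \<mu> where sets: "sets \<mu> = sets borel" and prob: "prob_space \<mu>"
    and lim: "\<And>\<phi>. continuous_on UNIV \<phi> \<Longrightarrow>
      (\<lambda>n. (\<Sum>j<n. \<phi> ((T ^^ j) z)) / real n) \<longlonglongrightarrow> (\<integral>x. \<phi> x \<partial>\<mu>)"
    using limit_periodic_distribution[OF comp z] by blast
  interpret prob_space \<mu> by (rule prob)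
  note sets[measurable_cong]
  have [measurable]: "T \<in> borel_measurable borel"
    using T by (rule borel_measurable_continuous_onI)
  have basin: "z \<in> basin T \<mu>"
    using lim by (simp add: basin_def birkhoff_average_def[abs_def])
  have uniform: "\<exists>N. \<forall>n\<ge>N. \<forall>i. \<bar>birkhoff_average T \<phi> ((T ^^ i) z) n - (\<integral>x. \<phi> x \<partial>\<mu>)\<bar> < \<eta>"
    if \<phi>: "continuous_on UNIV \<phi>" and \<eta>: "\<eta> > 0" for \<phi> :: "'a \<Rightarrow> real" and \<eta>
  proof -
    have "limit_periodic (\<lambda>n. \<phi> ((T ^^ n) z))"
      using z compact_uniformly_continuous[OF \<phi> comp] by (rule limit_periodic_compose)
    then obtain c where "(\<lambda>n. (\<Sum>j<n. \<phi> ((T ^^ j) z)) / real n) \<longlonglongrightarrow> c"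
      and c: "\<And>\<eta>. \<eta> > 0 \<Longrightarrow> \<exists>N. \<forall>n\<ge>N. \<forall>i. \<bar>(\<Sum>j<n. \<phi> ((T ^^ (i + j)) z)) / real n - c\<bar> < \<eta>"
      using limit_periodic_mean by blast
    then have "c = (\<integral>x. \<phi> x \<partial>\<mu>)" using lim[OF \<phi>] LIMSEQ_unique by blast
    moreover have "(T ^^ j) ((T ^^ i) z) = (T ^^ (i + j)) z" for i j
      by (metis add.commute comp_apply funpow_add)
    ultimately show ?thesis using c[OF \<eta>] by (simp add: birkhoff_average_def)
  qed
  \<comment> \<open>\<open>\<mu>\<close> is carried by the closure of the orbit, in a form suited to continuous functions\<close>
  have vanish: "AE x in \<mu>. \<psi> x = 0"
    if \<psi>: "continuous_on UNIV \<psi>" "\<And>x. \<psi> x \<ge> 0" "\<And>i. \<psi> ((T ^^ i) z) = 0" for \<psi> :: "'a \<Rightarrow> real"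
  proof -
    have [measurable]: "\<psi> \<in> borel_measurable borel"
      using \<psi>(1) by (rule borel_measurable_continuous_onI)
    obtain B where "\<And>x. \<bar>\<psi> x\<bar> \<le> B"
      using compact_imp_continuous_bounded[OF comp \<psi>(1)] by blast
    then have int: "integrable \<mu> \<psi>" by (intro integrable_const_bound[where B=B]) auto
    have "(\<integral>x. \<psi> x \<partial>\<mu>) = 0"
      using LIMSEQ_unique[OF lim[OF \<psi>(1)], of 0] \<psi>(3) by simp
    then show ?thesis using integral_nonneg_eq_0_iff_AE[OF int] \<psi>(2) by auto
  qed
  have inv: "\<mu> \<in> invariant_measures T"
  proof -
    have "distr \<mu> borel T = \<mu>"
    proof (rule borel_measure_eqI_continuous)
      show "prob_space (distr \<mu> borel T)" by (rule prob_space_distr) simp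
      fix \<phi> :: "'a \<Rightarrow> real" assume \<phi>: "continuous_on UNIV \<phi>"
      have [measurable]: "\<phi> \<in> borel_measurable borel"
        using \<phi> by (rule borel_measurable_continuous_onI)
      have "continuous_on UNIV (\<lambda>x. \<phi> (T x))"
        using continuous_on_compose2[OF \<phi> T] by simp
      from lim[OF this] have "(\<lambda>n. birkhoff_average T \<phi> (T z) n) \<longlonglongrightarrow> (\<integral>x. \<phi> (T x) \<partial>\<mu>)"
        by (simp add: birkhoff_average_def funpow_swap1)
      moreover have "(\<lambda>n. birkhoff_average T \<phi> (T z) n) \<longlonglongrightarrow> (\<integral>x. \<phi> x \<partial>\<mu>)"
        unfolding lim_sequentially dist_real_def
      proof (intro allI impI)
        fix r :: real assume "r > 0"
        then obtain N where "\<And>n i. n \<ge> N \<Longrightarrow>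
            \<bar>birkhoff_average T \<phi> ((T ^^ i) z) n - (\<integral>x. \<phi> x \<partial>\<mu>)\<bar> < r"
          using uniform[OF \<phi>] by blast
        from this[of _ 1]
        show "\<exists>N. \<forall>n\<ge>N. \<bar>birkhoff_average T \<phi> (T z) n - (\<integral>x. \<phi> x \<partial>\<mu>)\<bar> < r"
          by auto
      qed
      ultimately have "(\<integral>x. \<phi> (T x) \<partial>\<mu>) = (\<integral>x. \<phi> x \<partial>\<mu>)" by (rule LIMSEQ_unique)
      then show "(\<integral>x. \<phi> x \<partial>distr \<mu> borel T) = (\<integral>x. \<phi> x \<partial>\<mu>)" by (simp add: integral_distr)
    qed (use prob sets in auto)
    then show ?thesis using sets prob by (simp add: invariant_measures_def)
  qed
  have erg: "measure \<mu> A = 0 \<or> measure \<mu> A = 1"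
    if A: "A \<in> sets borel" and TA: "T -` A = A" for A
  proof (rule disjCI)
    assume "measure \<mu> A \<noteq> 1"
    show "measure \<mu> A = 0"
    proof (rule ccontr)
      assume nz: "measure \<mu> A \<noteq> 0"
      have [measurable]: "A \<in> sets borel" by fact
      have A_nz: "emeasure \<mu> A \<noteq> 0" "emeasure \<mu> A \<noteq> \<infinity>"
        using nz by (auto simp: emeasure_eq_measure)
      define \<nu> where "\<nu> = uniform_measure \<mu> A"
      have \<nu>_prob: "prob_space \<nu>" unfolding \<nu>_def by (rule prob_space_uniform_measure[OF A_nz])
      have \<nu>_sets: "sets \<nu> = sets borel" by (simp add: \<nu>_def sets)
      have "distr \<nu> borel T = \<nu>"
      proof (rule measure_eqI)
        fix E assume "E \<in> sets (distr \<nu> borel T)"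
        then have [measurable]: "E \<in> sets borel" by simp
        have [measurable]: "T -` E \<in> sets borel"
          using measurable_sets[of T borel borel E] by simp
        have [measurable]: "T -` (A \<inter> E) \<in> sets borel"
          using measurable_sets[of T borel borel "A \<inter> E"] by simp
        have sp: "space \<mu> = UNIV" "space \<nu> = UNIV"
          using sets_eq_imp_space_eq[OF sets] sets_eq_imp_space_eq[OF \<nu>_sets] by auto
        have "emeasure (distr \<nu> borel T) E = emeasure \<nu> (T -` E)"
          using sp measurable_cong_sets[OF \<nu>_sets refl, of borel] by (subst emeasure_distr) auto
        also have "\<dots> = emeasure \<mu> (A \<inter> T -` E) / emeasure \<mu> A"
          unfolding \<nu>_def by (rule emeasure_uniform_measure) (simp_all add: sets)
        also have "A \<inter> T -` E = T -` (A \<inter> E)" using TA by auto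
        also have "emeasure \<mu> (T -` (A \<inter> E)) = emeasure (distr \<mu> borel T) (A \<inter> E)"
          using sp by (subst emeasure_distr) auto
        also have "\<dots> = emeasure \<mu> (A \<inter> E)"
          using inv by (simp add: invariant_measures_def)
        also have "\<dots> / emeasure \<mu> A = emeasure \<nu> E"
          unfolding \<nu>_def by (rule emeasure_uniform_measure[symmetric]) (simp_all add: sets)
        finally show "emeasure (distr \<nu> borel T) E = emeasure \<nu> E" .
      qed (simp add: \<nu>_sets)
      then have \<nu>_inv: "\<nu> \<in> invariant_measures T"
        using \<nu>_prob \<nu>_sets by (simp add: invariant_measures_def)
      have "\<nu> = \<mu>"
      proof (rule borel_measure_eqI_continuous[OF \<nu>_prob \<nu>_sets prob sets])
        fix \<phi> :: "'a \<Rightarrow> real" assume \<phi>: "continuous_on UNIV \<phi>"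
        let ?c = "\<integral>x. \<phi> x \<partial>\<mu>"
        have "\<bar>(\<integral>x. \<phi> x \<partial>\<nu>) - ?c\<bar> \<le> \<eta>" if \<eta>: "\<eta> > 0" for \<eta>
        proof -
          obtain N where N: "\<And>n i. n \<ge> N \<Longrightarrow> \<bar>birkhoff_average T \<phi> ((T ^^ i) z) n - ?c\<bar> < \<eta>"
            using uniform[OF \<phi> \<eta>] by blast
          define n where "n = Suc N"
          let ?b = "\<lambda>x. birkhoff_average T \<phi> x n"
          have b_cont: "continuous_on UNIV ?b" by (rule continuous_on_birkhoff_average[OF T \<phi>])
          have "AE x in \<mu>. max 0 (\<bar>?b x - ?c\<bar> - \<eta>) = 0"
          proof (rule vanish)
            show "continuous_on UNIV (\<lambda>x. max 0 (\<bar>?b x - ?c\<bar> - \<eta>))"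
              by (intro continuous_intros b_cont)
            show "max 0 (\<bar>?b ((T ^^ i) z) - ?c\<bar> - \<eta>) = 0" for i
              using N[of n i] by (simp add: n_def)
          qed simp
          then have "AE x in \<mu>. \<bar>?b x - ?c\<bar> \<le> \<eta>"
            by eventually_elim linarith
          then have AE\<nu>: "AE x in \<nu>. \<bar>?b x - ?c\<bar> \<le> \<eta>"
            unfolding \<nu>_def by (intro AE_uniform_measureI) (auto simp: sets)
          interpret \<nu>: prob_space \<nu> by (rule \<nu>_prob)
          note \<nu>_sets[measurable_cong]
          have [measurable]: "?b \<in> borel_measurable borel"
            by (rule borel_measurable_continuous_onI[OF b_cont])
          obtain B where "\<And>x. \<bar>?b x\<bar> \<le> B"
            using compact_imp_continuous_bounded[OF comp b_cont] by blast
          then have int: "integrable \<nu> ?b" by (intro \<nu>.integrable_const_bound[where B=B]) auto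
          have "AE x in \<nu>. ?b x \<le> ?c + \<eta>" "AE x in \<nu>. ?b x \<ge> ?c - \<eta>"
            using AE\<nu> by (eventually_elim, linarith)+
          then have "(\<integral>x. ?b x \<partial>\<nu>) \<le> ?c + \<eta>" "(\<integral>x. ?b x \<partial>\<nu>) \<ge> ?c - \<eta>"
            using \<nu>.integral_le_const[OF int] \<nu>.integral_ge_const[OF int] by auto
          then have "\<bar>(\<integral>x. ?b x \<partial>\<nu>) - ?c\<bar> \<le> \<eta>" by linarith
          then show ?thesis
            using integral_birkhoff_average[OF comp T \<nu>_inv \<phi>, of n] by (simp add: n_def)
        qed
        then have "\<bar>(\<integral>x. \<phi> x \<partial>\<nu>) - ?c\<bar> \<le> 0" by (rule field_le_epsilon[of _ 0, simplified])
        then show "(\<integral>x. \<phi> x \<partial>\<nu>) = ?c" by simp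
      qed
      moreover have "measure \<nu> A = 1"
        unfolding \<nu>_def using nz A A_nz sets by (subst measure_uniform_measure) auto
      ultimately show False using \<open>measure \<mu> A \<noteq> 1\<close> by simp
    qed
  qed
  have supp: "z \<in> measure_support \<mu>"
    unfolding measure_support_def
  proof (safe, rule ccontr)
    fix U assume U: "open U" "z \<in> U" "\<not> emeasure \<mu> U > 0"
    obtain r where r: "r > 0" "ball z r \<subseteq> U" using U openE by blast
    define \<psi> where "\<psi> x = max 0 (r - dist z x)" for x
    have \<psi>_cont: "continuous_on UNIV \<psi>" unfolding \<psi>_def by (intro continuous_intros)
    have \<psi>_nonneg: "\<psi> x \<ge> 0" for x by (simp add: \<psi>_def)
    have "U \<in> null_sets \<mu>" using U by (intro null_setsI) (auto simp: sets)
    then have "AE x in \<mu>. x \<notin> U" by (rule AE_not_in)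
    then have "AE x in \<mu>. \<psi> x = 0"
      by eventually_elim (use r in \<open>force simp: \<psi>_def\<close>)
    then have int0: "(\<integral>x. \<psi> x \<partial>\<mu>) = 0" by (rule integral_eq_zero_AE)
    obtain p where p: "p > 0"
      "\<And>j k. j mod p = k mod p \<Longrightarrow> dist ((T ^^ j) z) ((T ^^ k) z) < r / 2"
      using z r(1) unfolding limit_periodic_def by (meson half_gt_zero)
    have visit: "\<psi> ((T ^^ (k * p)) z) \<ge> r / 2" for k
    proof -
      have "dist ((T ^^ 0) z) ((T ^^ (k * p)) z) < r / 2" by (rule p(2)) simp
      then have "dist z ((T ^^ (k * p)) z) < r / 2" by simp
      then show ?thesis unfolding \<psi>_def by linarith
    qed
    have low: "(\<Sum>j<k * p. \<psi> ((T ^^ j) z)) \<ge> real k * (r / 2)" for k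
    proof (induction k)
      case (Suc k)
      have "(\<Sum>j<Suc k * p. \<psi> ((T ^^ j) z))
          = (\<Sum>j<k * p. \<psi> ((T ^^ j) z)) + (\<Sum>j=k * p..<Suc k * p. \<psi> ((T ^^ j) z))"
        unfolding lessThan_atLeast0 by (rule sum.atLeastLessThan_concat[symmetric]) auto
      moreover have "(\<Sum>j=k * p..<Suc k * p. \<psi> ((T ^^ j) z)) \<ge> \<psi> ((T ^^ (k * p)) z)"
        using p(1) \<psi>_nonneg by (intro member_le_sum) auto
      ultimately show ?case using Suc visit[of k] by (simp add: algebra_simps)
    qed simp
    have "(\<lambda>k. (\<Sum>j<k * p. \<psi> ((T ^^ j) z)) / real (k * p)) \<longlonglongrightarrow> 0"
      using filterlim_compose[OF lim[OF \<psi>_cont] mult_nat_right_at_top[OF p(1)]] int0 by simp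
    moreover have "\<forall>\<^sub>F k in sequentially. r / 2 / real p \<le> (\<Sum>j<k * p. \<psi> ((T ^^ j) z)) / real (k * p)"
      using eventually_gt_at_top[of 0]
    proof eventually_elim
      case (elim k)
      then show ?case using low[of k] p(1) by (simp add: field_simps)
    qed
    ultimately have "r / 2 / real p \<le> 0" using tendsto_lowerbound by force
    then show False using r(1) p(1) by (simp add: field_simps)
  qed
  show thesis
    using that[of \<mu>] inv erg basin supp by (simp add: ergodic_measures_def)
qed

text \<open>
If the averages of \<open>\<phi>\<close> eventually exceeded \<open>a\<close> along every orbit, then dominated convergence would
give \<open>\<integral>\<phi> d\<mu> \<ge> a\<close>, since the averages all have integral \<open>\<integral>\<phi> d\<mu>\<close>.
\<close>

lemma frequently_average_le_integral:
  fixes T :: "'a::metric_space \<Rightarrow> 'a"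
  assumes comp: "compact (UNIV :: 'a set)" and T: "continuous_on UNIV T"
    and \<mu>: "\<mu> \<in> invariant_measures T" and \<phi>: "continuous_on UNIV \<phi>"
    and a: "(\<integral>x. \<phi> x \<partial>\<mu>) < a"
  shows "\<exists>y. \<exists>\<^sub>F n in sequentially. birkhoff_average T \<phi> y n \<le> a"
proof (rule ccontr)
  assume "\<not> ?thesis"
  then have ev: "\<forall>\<^sub>F n in sequentially. a < birkhoff_average T \<phi> y n" for y
    by (simp add: not_frequently not_le)
  have sets[measurable_cong]: "sets \<mu> = sets borel"
    using \<mu> by (auto simp: invariant_measures_def)
  interpret prob_space \<mu> using \<mu> by (auto simp: invariant_measures_def)
  let ?b = "\<lambda>n x. birkhoff_average T \<phi> x n"
  have b_meas: "?b n \<in> borel_measurable borel" for n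
    by (rule borel_measurable_continuous_onI[OF continuous_on_birkhoff_average[OF T \<phi>]])
  note b_meas[measurable]
  obtain B where B: "\<And>x. \<bar>\<phi> x\<bar> \<le> B"
    using compact_imp_continuous_bounded[OF comp \<phi>] by blast
  have bB: "\<bar>?b n x\<bar> \<le> B" for n x by (rule abs_birkhoff_average_le[OF B])
  have "(\<lambda>n. \<integral>x. min (?b n x) a \<partial>\<mu>) \<longlonglongrightarrow> (\<integral>x. a \<partial>\<mu>)"
  proof (rule integral_dominated_convergence[where w="\<lambda>_. B + \<bar>a\<bar>"])
    show "AE x in \<mu>. (\<lambda>n. min (?b n x) a) \<longlonglongrightarrow> a"
    proof (rule AE_I2)
      fix x
      show "(\<lambda>n. min (?b n x) a) \<longlonglongrightarrow> a"
        by (rule tendsto_eventually) (use ev[of x] in \<open>auto elim: eventually_mono\<close>)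
    qed
    show "AE x in \<mu>. norm (min (?b n x) a) \<le> B + \<bar>a\<bar>" for n
    proof (rule AE_I2)
      fix x
      show "norm (min (?b n x) a) \<le> B + \<bar>a\<bar>" using bB[of x n] by (auto simp: min_def)
    qed
  qed auto
  then have lim: "(\<lambda>n. \<integral>x. min (?b n x) a \<partial>\<mu>) \<longlonglongrightarrow> a" by (simp add: prob_space)
  have "\<forall>\<^sub>F n in sequentially. (\<integral>x. min (?b n x) a \<partial>\<mu>) \<le> (\<integral>x. \<phi> x \<partial>\<mu>)"
    using eventually_gt_at_top[of 0]
  proof eventually_elim
    case (elim n)
    have "(\<integral>x. min (?b n x) a \<partial>\<mu>) \<le> (\<integral>x. ?b n x \<partial>\<mu>)"
    proof (rule integral_mono)
      show "integrable \<mu> (?b n)"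
        by (rule integrable_const_bound[where B=B]) (use bB in auto)
      show "integrable \<mu> (\<lambda>x. min (?b n x) a)"
      proof (rule integrable_const_bound[where B="B + \<bar>a\<bar>"])
        show "AE x in \<mu>. norm (min (?b n x) a) \<le> B + \<bar>a\<bar>"
        proof (rule AE_I2)
          fix x
          show "norm (min (?b n x) a) \<le> B + \<bar>a\<bar>" using bB[of x n] by (auto simp: min_def)
        qed
      qed measurable
    qed simp
    then show ?case using integral_birkhoff_average[OF comp T \<mu> \<phi> elim] by simp
  qed
  then have "a \<le> (\<integral>x. \<phi> x \<partial>\<mu>)" using tendsto_upperbound[OF lim] by simp
  then show False using a by simp
qed

text \<open>
Two invariant measures differ on some continuous \<open>\<phi>\<close>; the previous estimate, applied to \<open>\<phi>\<close> and one
measure and to \<open>-\<phi>\<close> and the other, finds orbits on both sides of a gap between the integrals.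
\<close>

lemma distinct_invariant_measures_gap:
  fixes T :: "'a::metric_space \<Rightarrow> 'a"
  assumes comp: "compact (UNIV :: 'a set)" and T: "continuous_on UNIV T"
    and \<mu>: "\<mu> \<in> invariant_measures T" and \<nu>: "\<nu> \<in> invariant_measures T" and "\<mu> \<noteq> \<nu>"
  obtains \<phi> c d y y' where "continuous_on UNIV \<phi>" "c < d"
    "\<exists>\<^sub>F n in sequentially. birkhoff_average T \<phi> y n \<le> c"
    "\<exists>\<^sub>F n in sequentially. d \<le> birkhoff_average T \<phi> y' n"
proof -
  note result = that
  have gap: thesis
    if \<mu>: "\<mu> \<in> invariant_measures T" and \<nu>: "\<nu> \<in> invariant_measures T"
      and \<phi>: "continuous_on UNIV \<phi>" and less: "(\<integral>x. \<phi> x \<partial>\<mu>) < (\<integral>x. \<phi> x \<partial>\<nu>)"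
    for \<mu> \<nu> :: "'a measure" and \<phi> :: "'a \<Rightarrow> real"
  proof -
    define c where "c = (2 * (\<integral>x. \<phi> x \<partial>\<mu>) + (\<integral>x. \<phi> x \<partial>\<nu>)) / 3"
    define d where "d = ((\<integral>x. \<phi> x \<partial>\<mu>) + 2 * (\<integral>x. \<phi> x \<partial>\<nu>)) / 3"
    have cd: "(\<integral>x. \<phi> x \<partial>\<mu>) < c" "c < d" "d < (\<integral>x. \<phi> x \<partial>\<nu>)"
      using less by (auto simp: c_def d_def)
    obtain y where y: "\<exists>\<^sub>F n in sequentially. birkhoff_average T \<phi> y n \<le> c"
      using frequently_average_le_integral[OF comp T \<mu> \<phi> cd(1)] by blast
    obtain y' where y': "\<exists>\<^sub>F n in sequentially. birkhoff_average T (\<lambda>x. - \<phi> x) y' n \<le> - d"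
      using frequently_average_le_integral[OF comp T \<nu>, of "\<lambda>x. - \<phi> x" "- d"] \<phi> cd(3)
      by (auto simp: continuous_on_minus)
    have "birkhoff_average T (\<lambda>x. - \<phi> x) y' n = - birkhoff_average T \<phi> y' n" for n
      by (simp add: birkhoff_average_def sum_negf)
    then have "\<exists>\<^sub>F n in sequentially. d \<le> birkhoff_average T \<phi> y' n" using y' by simp
    then show thesis using result[OF \<phi> cd(2) y] by blast
  qed
  have "\<exists>\<phi> :: 'a \<Rightarrow> real. continuous_on UNIV \<phi> \<and> (\<integral>x. \<phi> x \<partial>\<mu>) \<noteq> (\<integral>x. \<phi> x \<partial>\<nu>)"
  proof (rule ccontr)
    assume no: "\<not> ?thesis"
    have "\<mu> = \<nu>"
    proof (rule borel_measure_eqI_continuous)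
      show "prob_space \<mu>" "sets \<mu> = sets borel" "prob_space \<nu>" "sets \<nu> = sets borel"
        using \<mu> \<nu> unfolding invariant_measures_def by blast+
      show "(\<integral>x. f x \<partial>\<mu>) = (\<integral>x. f x \<partial>\<nu>)" if "continuous_on UNIV f" for f :: "'a \<Rightarrow> real"
        using no that by blast
    qed
    then show False using \<open>\<mu> \<noteq> \<nu>\<close> by contradiction
  qed
  then obtain \<phi> :: "'a \<Rightarrow> real"
    where \<phi>: "continuous_on UNIV \<phi>" "(\<integral>x. \<phi> x \<partial>\<mu>) \<noteq> (\<integral>x. \<phi> x \<partial>\<nu>)" by blast
  show thesis
  proof (cases "(\<integral>x. \<phi> x \<partial>\<mu>) < (\<integral>x. \<phi> x \<partial>\<nu>)")
    case True
    then show ?thesis by (rule gap[OF \<mu> \<nu> \<phi>(1)])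
  next
    case False
    then have "(\<integral>x. \<phi> x \<partial>\<nu>) < (\<integral>x. \<phi> x \<partial>\<mu>)" using \<phi>(2) by simp
    then show ?thesis by (rule gap[OF \<nu> \<mu> \<phi>(1)])
  qed
qed

section \<open>Extremal averages of generic points\<close>

text \<open>
Transitivity leads from near \<open>x\<close> to near \<open>y\<close>; jumping there onto the orbit of \<open>y\<close> makes a chain
with small errors at only one place, and a shadowing point of this chain is the required \<open>z\<close>.
\<close>

lemma orbit_followed_from_nearby:
  fixes T :: "'a::metric_space \<Rightarrow> 'a"
  assumes trans: "top_transitive T" and shad: "shadowing_property T" and e: "e > 0"
  obtains z m where "dist x z < e" "\<And>j. dist ((T ^^ (m + j)) z) ((T ^^ j) y) < e"
proof -
  obtain d where d: "d > 0"
    "\<And>x. (\<And>n. dist (T (x n)) (x (Suc n)) < d) \<Longrightarrow> \<exists>y. \<forall>n. dist ((T ^^ n) y) (x n) < e / 2"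
    using shadowing_from_0[OF shad, of "e / 2"] e by auto
  have "open (ball x (e / 2))" "ball x (e / 2) \<noteq> {}" "open (ball y d)" "ball y d \<noteq> {}"
    using e d(1) by auto
  then obtain m where m: "m \<ge> 1" "ball x (e / 2) \<inter> (T ^^ m) -` ball y d \<noteq> {}"
    using trans unfolding top_transitive_def by meson
  then obtain u where u: "dist x u < e / 2" "dist y ((T ^^ m) u) < d" by auto
  define s where "s j = (if j < m then (T ^^ j) u else (T ^^ (j - m)) y)" for j
  have "dist (T (s j)) (s (Suc j)) < d" for j
  proof -
    consider "Suc j < m" | "Suc j = m" | "m \<le> j" by linarith
    then show ?thesis
    proof cases
      case 2
      then have "T (s j) = (T ^^ m) u" by (auto simp: s_def)
      then show ?thesis using u(2) 2 by (simp add: s_def dist_commute)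
    qed (use d(1) in \<open>simp_all add: s_def Suc_diff_le\<close>)
  qed
  then obtain z where z: "\<And>n. dist ((T ^^ n) z) (s n) < e / 2" using d(2) by blast
  show thesis
  proof (rule that)
    have "dist z u < e / 2" using z[of 0] m(1) by (simp add: s_def)
    then show "dist x z < e" using u(1) dist_triangle2[of x z u] by linarith
    show "dist ((T ^^ (m + j)) z) ((T ^^ j) y) < e" for j
      using z[of "m + j"] e by (simp add: s_def)
  qed
qed

text \<open>
The orbit of \<open>z\<close> differs from one that follows \<open>y\<close> only by a delay of \<open>m\<close> steps. Since \<open>m\<close> is fixed
before \<open>n\<close> is chosen, the delay costs at most \<open>2mB/n\<close>, which is negligible at those large times \<open>n\<close> at
which the average along \<open>y\<close> is large.
\<close>

lemma large_averages_dense: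
  fixes T :: "'a::metric_space \<Rightarrow> 'a"
  assumes comp: "compact (UNIV :: 'a set)" and trans: "top_transitive T"
    and shad: "shadowing_property T" and \<phi>: "continuous_on UNIV \<phi>"
    and y: "\<exists>\<^sub>F n in sequentially. c' \<le> birkhoff_average T \<phi> y n" and c: "c < c'" and e: "e > 0"
  obtains z n where "dist x z < e" "n \<ge> N" "birkhoff_average T \<phi> z n > c"
proof -
  define \<eta> where "\<eta> = (c' - c) / 3"
  have \<eta>: "\<eta> > 0" using c by (simp add: \<eta>_def)
  obtain B where B: "B > 0" "\<And>x. \<bar>\<phi> x\<bar> \<le> B"
    using compact_imp_continuous_bounded[OF comp \<phi>] by blast
  obtain r where r: "r > 0" "\<And>x y. dist x y < r \<Longrightarrow> dist (\<phi> x) (\<phi> y) < \<eta>"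
    using compact_uniformly_continuous[OF \<phi> comp] \<eta>
    unfolding uniformly_continuous_on_def by (metis UNIV_I)
  obtain z m where z: "dist x z < min e r" "\<And>j. dist ((T ^^ (m + j)) z) ((T ^^ j) y) < min e r"
    using orbit_followed_from_nearby[OF trans shad, of "min e r" x y] e r(1) by auto
  obtain n0 :: nat where n0: "real n0 > 2 * real m * B / \<eta>" using reals_Archimedean2 by blast
  obtain n where n: "n \<ge> max N (Suc n0)" "c' \<le> birkhoff_average T \<phi> y n"
    using y unfolding frequently_sequentially by blast
  have n_pos: "real n > 0" and n_big: "2 * real m * B < real n * \<eta>"
  proof -
    have "real n > 2 * real m * B / \<eta>" using n0 n(1) by linarith
    then show "2 * real m * B < real n * \<eta>" using \<eta> by (simp add: field_simps)
  qed (use n(1) in simp)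
  \<comment> \<open>compare both \<open>?S (n + m)\<close> and \<open>?S n\<close> with the sum along the delayed orbit; each costs \<open>m\<close> terms\<close>
  let ?S = "\<lambda>k. \<Sum>j<k. \<phi> ((T ^^ j) z)"
  have "(\<Sum>j<n. \<phi> ((T ^^ j) y) - \<eta>) \<le> (\<Sum>j<n. \<phi> ((T ^^ (m + j)) z))"
  proof (rule sum_mono)
    fix j
    have "dist (\<phi> ((T ^^ (m + j)) z)) (\<phi> ((T ^^ j) y)) < \<eta>" using z(2)[of j] r(2) by simp
    then show "\<phi> ((T ^^ j) y) - \<eta> \<le> \<phi> ((T ^^ (m + j)) z)"
      unfolding dist_real_def by linarith
  qed
  moreover have "(\<Sum>j<n. \<phi> ((T ^^ j) y) - \<eta>) = real n * birkhoff_average T \<phi> y n - real n * \<eta>"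
    using n_pos by (simp add: sum_subtractf birkhoff_average_def)
  moreover have "real n * c' \<le> real n * birkhoff_average T \<phi> y n"
    using n(2) by (rule mult_left_mono) simp
  moreover have "?S (m + n) = ?S m + (\<Sum>j<n. \<phi> ((T ^^ (m + j)) z))"
    by (induction n) (simp_all add: algebra_simps)
  moreover have "?S (n + m) = ?S n + (\<Sum>j<m. \<phi> ((T ^^ (n + j)) z))"
    by (induction m) (simp_all add: algebra_simps)
  moreover have "\<bar>?S m\<bar> \<le> (\<Sum>j<m. B)"
    by (rule order_trans[OF sum_abs sum_mono]) (rule B)
  moreover have "\<bar>\<Sum>j<m. \<phi> ((T ^^ (n + j)) z)\<bar> \<le> (\<Sum>j<m. B)"
    by (rule order_trans[OF sum_abs sum_mono]) (rule B)
  ultimately have "?S n \<ge> real n * c' - real n * \<eta> - 2 * real m * B"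
    by (simp add: add.commute)
  then have "?S n > real n * (c' - 2 * \<eta>)"
    using n_big by (simp add: algebra_simps)
  moreover have "c' - 2 * \<eta> > c" using c by (simp add: \<eta>_def field_simps)
  then have "real n * (c' - 2 * \<eta>) > real n * c" using n_pos by simp
  ultimately have "birkhoff_average T \<phi> z n > c"
    using n_pos by (simp add: birkhoff_average_def field_simps)
  then show thesis using z(1) n(1) by (intro that[of z n]) auto
qed

text \<open>
On a compact space a continuous function is known up to a small error from a modulus of continuity at
one scale and rational approximations to its values on a finite net. There are countably many such
data, and picking one continuous function for each realizable datum gives a dense set in the
uniform norm.
\<close>

lemma countable_dense_observables:
  assumes comp: "compact (UNIV :: 'a::metric_space set)"
  obtains D :: "('a::metric_space \<Rightarrow> real) set" where "countable D" "\<And>\<psi>. \<psi> \<in> D \<Longrightarrow> continuous_on UNIV \<psi>"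
    "\<And>\<phi> \<eta>. continuous_on UNIV \<phi> \<Longrightarrow> \<eta> > 0 \<Longrightarrow> \<exists>\<psi>\<in>D. \<forall>x. \<bar>\<phi> x - \<psi> x\<bar> < \<eta>"
proof -
  have "\<exists>F. finite F \<and> (UNIV :: 'a set) \<subseteq> (\<Union>c\<in>F. ball c (1 / real (Suc k)))" for k
  proof -
    have "(UNIV :: 'a set) \<subseteq> (\<Union>c\<in>UNIV. ball c (1 / real (Suc k)))"
    proof
      fix x :: 'a
      have "x \<in> ball x (1 / real (Suc k))" by simp
      then show "x \<in> (\<Union>c\<in>UNIV. ball c (1 / real (Suc k)))" by blast
    qed
    then show ?thesis using compactE_image[OF comp, of UNIV "\<lambda>c. ball c (1 / real (Suc k))"]
      by (metis open_ball)
  qed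
  then obtain F :: "nat \<Rightarrow> 'a set" where F: "\<And>k. finite (F k)"
    "\<And>k. UNIV \<subseteq> (\<Union>c\<in>F k. ball c (1 / real (Suc k)))" by metis
  define R :: "nat \<Rightarrow> nat \<Rightarrow> ('a \<Rightarrow> real) \<Rightarrow> ('a \<Rightarrow> real) \<Rightarrow> bool" where
    "R k l g \<psi> \<longleftrightarrow> continuous_on UNIV \<psi>
      \<and> (\<forall>x y. dist x y < 1 / real (Suc k) \<longrightarrow> \<bar>\<psi> x - \<psi> y\<bar> < 1 / real (Suc l))
      \<and> (\<forall>c\<in>F k. \<bar>\<psi> c - g c\<bar> < 1 / real (Suc l))" for k l g \<psi>
  define I where "I = (SIGMA (k, l):(UNIV :: (nat \<times> nat) set). F k \<rightarrow>\<^sub>E (\<rat> :: real set))"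
  define J where "J = {((k, l), g) \<in> I. \<exists>\<psi>. R k l g \<psi>}"
  have "countable I"
    unfolding I_def
    by (intro countable_SIGMA) (auto split: prod.splits intro!: countable_PiE F countable_rat)
  then have J: "countable J" by (rule countable_subset[rotated]) (auto simp: J_def)
  define D where "D = (\<lambda>((k, l), g). SOME \<psi>. R k l g \<psi>) ` J"
  have R_some: "R k l g (SOME \<psi>. R k l g \<psi>)" if "((k, l), g) \<in> J" for k l g
    using that unfolding J_def by (auto intro: someI[of "R k l g"])
  show thesis
  proof (rule that)
    show "countable D" using J by (simp add: D_def)
    show "continuous_on UNIV \<psi>" if "\<psi> \<in> D" for \<psi>
      using that R_some unfolding D_def R_def by force
    fix \<phi> :: "'a \<Rightarrow> real" and \<eta> :: real
    assume \<phi>: "continuous_on UNIV \<phi>" and \<eta>: "\<eta> > 0"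
    obtain l where l: "1 / real (Suc l) < \<eta> / 4" using nat_approx_posE[of "\<eta> / 4"] \<eta> by auto
    obtain r where r: "r > 0" "\<And>x y. dist x y < r \<Longrightarrow> dist (\<phi> x) (\<phi> y) < 1 / real (Suc l)"
      using compact_uniformly_continuous[OF \<phi> comp]
      unfolding uniformly_continuous_on_def by (metis UNIV_I zero_less_divide_1_iff of_nat_0_less_iff zero_less_Suc)
    obtain k where k: "1 / real (Suc k) < r" using nat_approx_posE[OF r(1)] by auto
    have "\<exists>q\<in>\<rat>. \<bar>\<phi> c - q\<bar> < 1 / real (Suc l)" for c
    proof -
      obtain q where "q \<in> \<rat>" "\<phi> c - 1 / real (Suc l) < q" "q < \<phi> c"
        using Rats_dense_in_real[of "\<phi> c - 1 / real (Suc l)" "\<phi> c"] by auto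
      then show ?thesis by (intro bexI[of _ q]) auto
    qed
    then obtain g0 where g0: "\<And>c. g0 c \<in> \<rat>" "\<And>c. \<bar>\<phi> c - g0 c\<bar> < 1 / real (Suc l)" by metis
    define g where "g = restrict g0 (F k)"
    have R_\<phi>: "R k l g \<phi>"
      unfolding R_def g_def using \<phi> g0(2) r(2) k by (auto simp: dist_real_def)
    moreover have "((k, l), g) \<in> I" using g0(1) by (auto simp: I_def g_def)
    ultimately have in_J: "((k, l), g) \<in> J" by (auto simp: J_def)
    define \<psi> where "\<psi> = (SOME \<psi>. R k l g \<psi>)"
    have R_\<psi>: "R k l g \<psi>" unfolding \<psi>_def by (rule R_some[OF in_J])
    have "\<bar>\<phi> x - \<psi> x\<bar> < \<eta>" for x
    proof -
      obtain c where c: "c \<in> F k" "dist c x < 1 / real (Suc k)"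
      proof -
        have "x \<in> (\<Union>c\<in>F k. ball c (1 / real (Suc k)))" using F(2) by blast
        then show thesis using that by auto
      qed
      have "\<bar>\<phi> c - \<phi> x\<bar> < 1 / real (Suc l)" "\<bar>\<phi> c - g c\<bar> < 1 / real (Suc l)"
        using R_\<phi> c unfolding R_def by blast+
      moreover have "\<bar>\<psi> c - \<psi> x\<bar> < 1 / real (Suc l)" "\<bar>\<psi> c - g c\<bar> < 1 / real (Suc l)"
        using R_\<psi> c unfolding R_def by blast+
      ultimately show ?thesis using l by linarith
    qed
    moreover have "\<psi> \<in> D" unfolding D_def \<psi>_def using in_J by force
    ultimately show "\<exists>\<psi>\<in>D. \<forall>x. \<bar>\<phi> x - \<psi> x\<bar> < \<eta>" by blast
  qed
qed

text \<open>
Take all sets of points whose averages of \<open>\<psi>\<close> exceed \<open>q\<close> at some time beyond \<open>N\<close>, for \<open>\<psi>\<close> in a countable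
dense set of observables and \<open>q\<close> rational, and keep those that are dense. By
\<open>large_averages_dense\<close> a set is kept whenever averages above \<open>q + \<epsilon>\<close> recur along some orbit. These
sets are countably many, and uniform approximation extends the conclusion to every observable; the
lower limits follow by passing to \<open>-\<phi>\<close>.
\<close>

lemma generic_points_have_extremal_averages:
  fixes T :: "'a::metric_space \<Rightarrow> 'a"
  assumes comp: "compact (UNIV :: 'a set)" and T: "continuous_on UNIV T"
    and trans: "top_transitive T" and shad: "shadowing_property T"
  obtains \<G> where "countable \<G>" "\<And>G. G \<in> \<G> \<Longrightarrow> open G \<and> closure G = UNIV"
    "\<And>x y \<phi> c c'. x \<in> \<Inter>\<G> \<Longrightarrow> continuous_on UNIV \<phi> \<Longrightarrow> c < c'
      \<Longrightarrow> \<exists>\<^sub>F n in sequentially. c' \<le> birkhoff_average T \<phi> y n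
      \<Longrightarrow> \<exists>\<^sub>F n in sequentially. c \<le> birkhoff_average T \<phi> x n"
    "\<And>x y \<phi> c c'. x \<in> \<Inter>\<G> \<Longrightarrow> continuous_on UNIV \<phi> \<Longrightarrow> c' < c
      \<Longrightarrow> \<exists>\<^sub>F n in sequentially. birkhoff_average T \<phi> y n \<le> c'
      \<Longrightarrow> \<exists>\<^sub>F n in sequentially. birkhoff_average T \<phi> x n \<le> c"
proof -
  obtain D :: "('a \<Rightarrow> real) set" where D: "countable D" "\<And>\<psi>. \<psi> \<in> D \<Longrightarrow> continuous_on UNIV \<psi>"
    "\<And>\<phi> \<eta>. continuous_on UNIV \<phi> \<Longrightarrow> \<eta> > 0 \<Longrightarrow> \<exists>\<psi>\<in>D. \<forall>x. \<bar>\<phi> x - \<psi> x\<bar> < \<eta>"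
    using countable_dense_observables[OF comp] by blast
  define G where "G = (\<lambda>(\<psi>, q, N). {x. \<exists>n\<ge>N. birkhoff_average T \<psi> x n > q})"
  define \<G> where "\<G> = {U \<in> G ` (D \<times> \<rat> \<times> UNIV). closure U = UNIV}"
  have open_G: "open (G (\<psi>, q, N))" if "\<psi> \<in> D" for \<psi> q N
  proof -
    have "G (\<psi>, q, N) = (\<Union>n\<in>{N..}. {x. q < birkhoff_average T \<psi> x n})"
      by (auto simp: G_def)
    then show ?thesis
      using continuous_on_birkhoff_average[OF T D(2)[OF that]]
      by (auto intro!: open_UN open_Collect_less continuous_intros)
  qed
  have upper: "\<exists>\<^sub>F n in sequentially. c \<le> birkhoff_average T \<phi> x n"
    if x: "x \<in> \<Inter>\<G>" and \<phi>: "continuous_on UNIV \<phi>" and c: "c < c'"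
      and y: "\<exists>\<^sub>F n in sequentially. c' \<le> birkhoff_average T \<phi> y n" for x y \<phi> c c'
  proof -
    define \<eta> where "\<eta> = (c' - c) / 4"
    have \<eta>: "\<eta> > 0" using c by (simp add: \<eta>_def)
    obtain \<psi> where \<psi>: "\<psi> \<in> D" "\<And>x. \<bar>\<phi> x - \<psi> x\<bar> < \<eta>" using D(3)[OF \<phi> \<eta>] by blast
    have close: "\<bar>birkhoff_average T \<phi> w n - birkhoff_average T \<psi> w n\<bar> \<le> \<eta>" for w n
      by (rule birkhoff_average_close) (use \<psi>(2) \<eta> in \<open>auto simp: less_imp_le\<close>)
    have "c + \<eta> < c' - \<eta>" using c by (simp add: \<eta>_def field_simps)
    \<comment> \<open>replacing \<open>\<phi>\<close> by \<open>\<psi>\<close> costs \<open>\<eta>\<close> at \<open>y\<close> and again at \<open>x\<close>, hence the two margins around \<open>q\<close>\<close>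
    then obtain q where q: "q \<in> \<rat>" "c + \<eta> < q" "q < c' - \<eta>"
      using Rats_dense_in_real by blast
    have y': "\<exists>\<^sub>F n in sequentially. c' - \<eta> \<le> birkhoff_average T \<psi> y n"
      using y
    proof (rule frequently_elim1)
      fix n assume "c' \<le> birkhoff_average T \<phi> y n"
      then show "c' - \<eta> \<le> birkhoff_average T \<psi> y n" using close[of y n] by linarith
    qed
    have "x \<in> G (\<psi>, q, N)" for N
    proof -
      have "closure (G (\<psi>, q, N)) = UNIV"
      proof -
        have "w \<in> closure (G (\<psi>, q, N))" for w
          unfolding closure_approachable
        proof (intro allI impI)
          fix e :: real assume "e > 0"
          then obtain z n where "dist w z < e" "n \<ge> N" "birkhoff_average T \<psi> z n > q"
            using large_averages_dense[OF comp trans shad D(2)[OF \<psi>(1)] y' q(3)] by blast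
          then show "\<exists>z\<in>G (\<psi>, q, N). dist z w < e" by (auto simp: G_def dist_commute)
        qed
        then show ?thesis by blast
      qed
      then have "G (\<psi>, q, N) \<in> \<G>" using \<psi>(1) q(1) by (auto simp: \<G>_def)
      then show ?thesis using x by blast
    qed
    then have "\<forall>N. \<exists>n\<ge>N. birkhoff_average T \<psi> x n > q" by (auto simp: G_def)
    then have "\<exists>\<^sub>F n in sequentially. birkhoff_average T \<psi> x n > q"
      by (simp add: frequently_sequentially)
    then show ?thesis
    proof (rule frequently_elim1)
      fix n assume "birkhoff_average T \<psi> x n > q"
      then show "c \<le> birkhoff_average T \<phi> x n" using close[of x n] q(2) by linarith
    qed
  qed
  have neg: "birkhoff_average T (\<lambda>x. - \<phi> x) w n = - birkhoff_average T \<phi> w n" for \<phi> w n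
    by (simp add: birkhoff_average_def sum_negf)
  show thesis
  proof (rule that[of \<G>])
    have "countable (D \<times> (\<rat> :: real set) \<times> (UNIV :: nat set))"
      using D(1) countable_rat by auto
    then show "countable \<G>" unfolding \<G>_def by (rule countable_subset[OF _ countable_image, rotated]) auto
    show "open U \<and> closure U = UNIV" if "U \<in> \<G>" for U
      using that open_G unfolding \<G>_def by auto
    show "\<exists>\<^sub>F n in sequentially. birkhoff_average T \<phi> x n \<le> c"
      if "x \<in> \<Inter>\<G>" "continuous_on UNIV \<phi>" "c' < c"
        "\<exists>\<^sub>F n in sequentially. birkhoff_average T \<phi> y n \<le> c'" for x y \<phi> c c'
      using upper[OF that(1), of "\<lambda>x. - \<phi> x" "- c" "- c'" y] that(2-4)
      by (simp add: neg continuous_on_minus)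
  qed (rule upper)
qed

lemma compact_dense_Inter:
  assumes "compact (UNIV :: 'a::metric_space set)" "countable \<G>"
    and "\<And>G. G \<in> \<G> \<Longrightarrow> open G \<and> closure G = (UNIV :: 'a set)"
  shows "closure (\<Inter>\<G>) = UNIV"
  using Met_TC.metric_Baire_category[of \<G>] assms compact_imp_complete[OF assms(1)] by simp

text \<open>
If no gap \<open>c < d\<close> is crossed infinitely often, then the sequence converges to the infimum of its
eventual upper bounds.
\<close>

lemma bounded_divergent_oscillates:
  fixes a :: "nat \<Rightarrow> real"
  assumes B: "\<And>n. \<bar>a n\<bar> \<le> B" and div: "\<not> convergent a"
  obtains c d where "c < d" "\<exists>\<^sub>F n in sequentially. a n \<le> c" "\<exists>\<^sub>F n in sequentially. d \<le> a n"
proof (rule ccontr)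
  assume no: "\<not> thesis"
  define S where "S = {c. \<forall>\<^sub>F n in sequentially. a n \<le> c}"
  have "B \<in> S" using B by (auto simp: S_def abs_le_iff)
  have bdd: "bdd_below S"
  proof (rule bdd_belowI)
    fix c assume "c \<in> S"
    then obtain n where "a n \<le> c" unfolding S_def eventually_sequentially by auto
    then show "- B \<le> c" using B[of n] by linarith
  qed
  have "a \<longlonglongrightarrow> Inf S"
  proof (rule order_tendstoI)
    fix u assume "Inf S < u"
    then obtain s where "s \<in> S" "s < u" using cInf_lessD[of S u] \<open>B \<in> S\<close> by blast
    then show "\<forall>\<^sub>F n in sequentially. a n < u"
      unfolding S_def by (auto elim: eventually_mono)
  next
    fix l assume l: "l < Inf S"
    define m where "m = (l + Inf S) / 2"
    have m: "l < m" "m < Inf S" using l by (auto simp: m_def)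
    have "m \<notin> S" using m(2) cInf_lower[OF _ bdd, of m] by auto
    have "\<exists>\<^sub>F n in sequentially. m \<le> a n"
      unfolding frequently_def
    proof
      assume "\<forall>\<^sub>F n in sequentially. \<not> m \<le> a n"
      then have "\<forall>\<^sub>F n in sequentially. a n \<le> m" by eventually_elim simp
      then show False using \<open>m \<notin> S\<close> by (simp add: S_def)
    qed
    then have "\<not> (\<exists>\<^sub>F n in sequentially. a n \<le> l)" using no that m(1) by blast
    then show "\<forall>\<^sub>F n in sequentially. l < a n"
      by (simp add: not_frequently not_le)
  qed
  then show False using div by (auto simp: convergent_def)
qed

lemma oscillates_imp_divergent:
  fixes a :: "nat \<Rightarrow> real"
  assumes "c < d" "\<exists>\<^sub>F n in sequentially. a n \<le> c" "\<exists>\<^sub>F n in sequentially. d \<le> a n"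
  shows "\<not> convergent a"
proof
  assume "convergent a"
  then obtain l where l: "a \<longlonglongrightarrow> l" by (auto simp: convergent_def)
  have "\<not> c < l" using order_tendstoD(1)[OF l, of c] assms(2)
    by (auto simp: frequently_def not_le)
  moreover have "\<not> l < d" using order_tendstoD(2)[OF l, of d] assms(3)
    by (auto simp: frequently_def not_le)
  ultimately show False using assms(1) by linarith
qed

section \<open>Sensitivity\<close>

text \<open>
Without sensitivity some ball consists of points whose orbits stay uniformly close to each other.
It contains points \<open>g\<close> and \<open>z\<close> with oscillating and with convergent averages, but these
averages differ by less than a fixed fraction of the oscillation.
\<close>

lemma sensitive_if_oscillation_and_convergence_dense:
  fixes T :: "'a::metric_space \<Rightarrow> 'a"
  assumes comp: "compact (UNIV :: 'a set)" and \<phi>: "continuous_on UNIV \<phi>" and cd: "c < d"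
    and osc: "\<And>x e. e > 0 \<Longrightarrow> \<exists>g. dist x g < e
      \<and> (\<exists>\<^sub>F n in sequentially. birkhoff_average T \<phi> g n \<le> c)
      \<and> (\<exists>\<^sub>F n in sequentially. d \<le> birkhoff_average T \<phi> g n)"
    and conv: "\<And>x e. e > 0 \<Longrightarrow> \<exists>z. dist x z < e \<and> convergent (birkhoff_average T \<phi> z)"
  shows "sensitive T"
proof -
  \<comment> \<open>the gap is bounded by \<open>4 * \<eta>\<close> below: twice from \<open>g\<close> to \<open>z\<close> and twice from the averages
    along \<open>z\<close> to their limit\<close>
  define \<eta> where "\<eta> = (d - c) / 5"
  have \<eta>: "\<eta> > 0" using cd by (simp add: \<eta>_def)
  obtain r where r: "r > 0" "\<And>x y. dist x y < r \<Longrightarrow> dist (\<phi> x) (\<phi> y) < \<eta>"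
    using compact_uniformly_continuous[OF \<phi> comp] \<eta>
    unfolding uniformly_continuous_on_def by (metis UNIV_I)
  define e where "e = r / 3"
  have e: "e > 0" using r(1) by (simp add: e_def)
  have "\<exists>z\<in>ball x \<delta>. (SUP n\<in>{1..}. ereal (dist ((T ^^ n) x) ((T ^^ n) z))) > ereal e"
    if \<delta>: "\<delta> > 0" for x \<delta>
  proof (rule ccontr)
    assume "\<not> ?thesis"
    then have sup: "(SUP n\<in>{1..}. ereal (dist ((T ^^ n) x) ((T ^^ n) z))) \<le> ereal e"
      if "dist x z < \<delta>" for z using that by (simp add: not_less)
    \<comment> \<open>the supremum ignores time 0, which the radius of the ball takes care of\<close>
    have near: "dist ((T ^^ n) x) ((T ^^ n) z) \<le> e" if z: "dist x z < min \<delta> e" for z n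
    proof (cases "n = 0")
      case False
      then have "ereal (dist ((T ^^ n) x) ((T ^^ n) z)) \<le> ereal e"
        using sup[of z] z by (auto simp: SUP_le_iff)
      then show ?thesis by simp
    qed (use z in simp)
    have pos: "min \<delta> e > 0" using \<delta> e by simp
    obtain g where g: "dist x g < min \<delta> e"
      "\<exists>\<^sub>F n in sequentially. birkhoff_average T \<phi> g n \<le> c"
      "\<exists>\<^sub>F n in sequentially. d \<le> birkhoff_average T \<phi> g n"
      using osc[OF pos] by blast
    obtain z l where z: "dist x z < min \<delta> e" "birkhoff_average T \<phi> z \<longlonglongrightarrow> l"
      using conv[OF pos] unfolding convergent_def by blast
    have close: "\<bar>birkhoff_average T \<phi> g n - birkhoff_average T \<phi> z n\<bar> \<le> \<eta>" for n
    proof (rule birkhoff_average_close)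
      fix j
      have "dist ((T ^^ j) g) ((T ^^ j) z) \<le> e + e"
        using near[OF g(1), of j] near[OF z(1), of j]
          dist_triangle3[of "(T ^^ j) g" "(T ^^ j) z" "(T ^^ j) x"] by linarith
      then have "dist (\<phi> ((T ^^ j) g)) (\<phi> ((T ^^ j) z)) < \<eta>"
        using r by (intro r(2)) (simp add: e_def)
      then show "\<bar>\<phi> ((T ^^ j) g) - \<phi> ((T ^^ j) z)\<bar> \<le> \<eta>" by (simp add: dist_real_def)
    qed (use \<eta> in simp)
    have ev: "\<forall>\<^sub>F n in sequentially. \<bar>birkhoff_average T \<phi> z n - l\<bar> < \<eta>"
      using tendstoD[OF z(2) \<eta>] by (simp add: dist_real_def)
    obtain n where "birkhoff_average T \<phi> g n \<le> c" "\<bar>birkhoff_average T \<phi> z n - l\<bar> < \<eta>"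
      using frequently_ex[OF frequently_eventually_conj[OF g(2) ev]] by blast
    moreover obtain m where "d \<le> birkhoff_average T \<phi> g m" "\<bar>birkhoff_average T \<phi> z m - l\<bar> < \<eta>"
      using frequently_ex[OF frequently_eventually_conj[OF g(3) ev]] by blast
    ultimately have "d - c \<le> 4 * \<eta>" using close[of n] close[of m] by linarith
    then show False using cd by (simp add: \<eta>_def)
  qed
  then show ?thesis unfolding sensitive_def using e by blast
qed

section \<open>Positive topological entropy\<close>

definition chain_loop :: "('a::metric_space \<Rightarrow> 'a) \<Rightarrow> real \<Rightarrow> 'a \<Rightarrow> nat \<Rightarrow> (nat \<Rightarrow> 'a) \<Rightarrow> bool" where
  "chain_loop T \<delta> x l c \<longleftrightarrow>
     c 0 = x \<and> c l = x \<and> (\<forall>i<l. dist (T (c i)) (c (Suc i)) < \<delta>)"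

text \<open>
After following the orbit of \<open>z\<close> for \<open>n\<close> steps, transitivity supplies a return to \<open>x\<close>. The time of that
return cannot be prescribed, so loops through different orbits may have different lengths.
\<close>

lemma chain_loop_through_orbit:
  assumes trans: "top_transitive T" and d: "d > 0" and n: "n \<ge> 1" and xz: "dist (T x) (T z) < d"
  obtains l c where "chain_loop T d x l c" "n < l" "c n = (T ^^ n) z"
proof -
  have "open (ball ((T ^^ Suc n) z) d)" "ball ((T ^^ Suc n) z) d \<noteq> {}"
    "open (ball x d)" "ball x d \<noteq> {}" using d by auto
  then obtain m where m: "m \<ge> 1" "ball ((T ^^ Suc n) z) d \<inter> (T ^^ m) -` ball x d \<noteq> {}"
    using trans unfolding top_transitive_def by meson
  then obtain u where u: "dist ((T ^^ Suc n) z) u < d" "dist x ((T ^^ m) u) < d" by auto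
  \<comment> \<open>the loop visits \<open>x, T z, \<dots>, T\<^sup>n z, u, T u, \<dots>, T\<^bsup>m - 1\<^esup> u, x\<close>\<close>
  define c where "c i = (if i = 0 \<or> i = n + 1 + m then x
      else if i \<le> n then (T ^^ i) z else (T ^^ (i - n - 1)) u)" for i
  have "dist (T (c i)) (c (Suc i)) < d" if i: "i < n + 1 + m" for i
  proof -
    consider "i = 0" | "0 < i" "i < n" | "i = n" | "n < i" "i < n + m" | "i = n + m"
      using i n by linarith
    then show ?thesis
    proof cases
      case 1
      then show ?thesis using xz n by (simp add: c_def)
    next
      case 2
      then show ?thesis using d by (simp add: c_def)
    next
      case 3
      then show ?thesis using u(1) n m(1) by (simp add: c_def)
    next
      case 4
      then have "i - n = Suc (i - n - 1)" by simp
      then have "(T ^^ (i - n)) u = T ((T ^^ (i - n - 1)) u)" by (metis funpow.simps(2) o_apply)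
      then show ?thesis using 4 d by (simp add: c_def)
    next
      case 5
      have "m = Suc (m - 1)" using m(1) by simp
      then have "(T ^^ m) u = T ((T ^^ (m - 1)) u)" by (metis funpow.simps(2) o_apply)
      then show ?thesis using 5 u(2) m(1) n by (simp add: c_def dist_commute)
    qed
  qed
  then have "chain_loop T d x (n + 1 + m) c" by (auto simp: chain_loop_def c_def)
  moreover have "c n = (T ^^ n) z" using n by (simp add: c_def)
  ultimately show thesis using that by simp
qed

lemma chain_loop_append:
  assumes "chain_loop T d x l c" "chain_loop T d x l' c'"
  shows "chain_loop T d x (l + l') (\<lambda>i. if i < l then c i else c' (i - l))"
  unfolding chain_loop_def
proof (intro conjI allI impI)
  fix i assume i: "i < l + l'"
  consider "Suc i < l" | "Suc i = l" | "l \<le> i" by linarith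
  then show "dist (T (if i < l then c i else c' (i - l)))
      (if Suc i < l then c (Suc i) else c' (Suc i - l)) < d"
  proof cases
    case 2
    then have "dist (T (c i)) (c l) < d" using assms(1) by (auto simp: chain_loop_def)
    moreover have "c l = c' 0" using assms by (simp add: chain_loop_def)
    ultimately show ?thesis using 2 by auto
  qed (use assms i in \<open>auto simp: chain_loop_def Suc_diff_le\<close>)
qed (use assms in \<open>auto simp: chain_loop_def\<close>)

text \<open>
Both loops begin and end at \<open>x\<close>, so no extra error arises at the junctions. Coding the choices by a set \<open>W\<close>
of block numbers makes the \<open>2\<^sup>k\<close> itineraries of \<open>k\<close> blocks the subsets of \<open>{..<k}\<close>.
\<close>

lemma concatenated_loops_chain:
  fixes W :: "nat set"
  assumes loops: "\<And>b. chain_loop T d x l (\<gamma> b)" and l: "l > 0"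
  defines "s \<equiv> \<lambda>j. \<gamma> (j div l \<in> W) (j mod l)"
  shows "dist (T (s j)) (s (Suc j)) < d"
proof -
  have step: "dist (T (s j)) (\<gamma> (j div l \<in> W) (Suc (j mod l))) < d"
    using loops[of "j div l \<in> W"] l by (simp add: chain_loop_def s_def)
  have "\<gamma> (j div l \<in> W) (Suc (j mod l)) = s (Suc j)"
  proof (cases "Suc (j mod l) = l")
    case True
    then show ?thesis
      using loops by (simp add: chain_loop_def s_def mod_Suc)
  next
    case False
    then show ?thesis by (simp add: s_def mod_Suc div_Suc)
  qed
  then show ?thesis using step by simp
qed

lemma le_limsup_if_frequently:
  fixes f :: "nat \<Rightarrow> ereal"
  assumes "\<And>N. \<exists>n\<ge>N. c \<le> f n"
  shows "c \<le> limsup f"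
  unfolding limsup_INF_SUP
proof (rule INF_greatest)
  fix N
  obtain n where "n \<ge> N" "c \<le> f n" using assms by blast
  then show "c \<le> (SUP m\<in>{N..}. f m)" by (meson SUP_upper2 atLeast_iff)
qed

text \<open>
Sensitivity supplies \<open>x\<close> and a nearby \<open>z\<close> with \<open>T\<^sup>n x\<close> and \<open>T\<^sup>n z\<close> far apart. Let \<open>\<alpha>\<close> and \<open>\<beta>\<close> be loops at
\<open>x\<close> through the orbits of \<open>x\<close> and \<open>z\<close>. Their lengths may differ, but \<open>\<alpha>\<beta>\<close> and \<open>\<beta>\<alpha>\<close>
have the same length \<open>l\<close> and are far apart at time \<open>n\<close>. Shadowing the concatenations of \<open>k\<close> such blocks
gives \<open>2\<^sup>k\<close> points that are separated before time \<open>kl\<close>, so the entropy is at least \<open>(ln 2)/l\<close>.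
\<close>

lemma sensitive_shadowing_positive_entropy:
  fixes T :: "'a::metric_space \<Rightarrow> 'a"
  assumes T: "continuous_on UNIV T" and trans: "top_transitive T"
    and shad: "shadowing_property T" and sens: "sensitive T"
  shows "topological_entropy T > 0"
proof -
  obtain e where e: "e > 0" and e_sens: "\<And>x \<delta>. \<delta> > 0 \<Longrightarrow>
      \<exists>z\<in>ball x \<delta>. (SUP n\<in>{1..}. ereal (dist ((T ^^ n) x) ((T ^^ n) z))) > ereal e"
    using sens unfolding sensitive_def by blast
  obtain d where d: "d > 0"
    "\<And>x. (\<And>n. dist (T (x n)) (x (Suc n)) < d) \<Longrightarrow> \<exists>y. \<forall>n. dist ((T ^^ n) y) (x n) < e / 4"
    using shadowing_from_0[OF shad, of "e / 4"] e by auto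
  fix x :: 'a
  obtain \<delta> where \<delta>: "\<delta> > 0" "\<And>z. dist z x < \<delta> \<Longrightarrow> dist (T z) (T x) < d"
    using T d(1) unfolding continuous_on_iff by (metis UNIV_I)
  obtain z where z: "dist x z < \<delta>"
    "(SUP n\<in>{1..}. ereal (dist ((T ^^ n) x) ((T ^^ n) z))) > ereal e"
    using e_sens[OF \<delta>(1)] by (metis mem_ball)
  then obtain n where n: "n \<ge> 1" "dist ((T ^^ n) x) ((T ^^ n) z) > e"
    by (auto simp: less_SUP_iff)
  have Txz: "dist (T x) (T z) < d" using \<delta>(2)[of z] z(1) by (simp add: dist_commute)
  obtain l1 \<alpha> where \<alpha>: "chain_loop T d x l1 \<alpha>" "n < l1" "\<alpha> n = (T ^^ n) x"
    using chain_loop_through_orbit[OF trans d(1) n(1), of x x] d(1) by auto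
  obtain l2 \<beta> where \<beta>: "chain_loop T d x l2 \<beta>" "n < l2" "\<beta> n = (T ^^ n) z"
    using chain_loop_through_orbit[OF trans d(1) n(1) Txz] by auto
  \<comment> \<open>both orders of the loops have length \<open>l\<close>, and both lengths exceed \<open>n\<close>, so that time \<open>n\<close> falls into
    the first of the two loops\<close>
  define l where "l = l1 + l2"
  define \<gamma> where "\<gamma> b = (if b then (\<lambda>i. if i < l1 then \<alpha> i else \<beta> (i - l1))
      else (\<lambda>i. if i < l2 then \<beta> i else \<alpha> (i - l2)))" for b
  have l: "l > 0" "n < l" using \<alpha>(2) by (auto simp: l_def)
  have loops: "chain_loop T d x l (\<gamma> b)" for b
    using chain_loop_append[OF \<alpha>(1) \<beta>(1)] chain_loop_append[OF \<beta>(1) \<alpha>(1)]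
    by (auto simp: \<gamma>_def l_def add.commute)
  have apart: "dist (\<gamma> b n) (\<gamma> b' n) > e" if "b \<noteq> b'" for b b'
    using that \<alpha>(2,3) \<beta>(2,3) n(2) by (cases b; cases b') (auto simp: \<gamma>_def dist_commute)
  have "\<exists>y. \<forall>j. dist ((T ^^ j) y) (\<gamma> (j div l \<in> W) (j mod l)) < e / 4" for W
    by (rule d(2)) (rule concatenated_loops_chain[OF loops l(1)])
  then obtain y where y: "\<And>W j. dist ((T ^^ j) (y W)) (\<gamma> (j div l \<in> W) (j mod l)) < e / 4"
    by metis
  have sep: "\<exists>j<k * l. dist ((T ^^ j) (y W)) ((T ^^ j) (y W')) > e / 2"
    if "W \<subseteq> {..<k}" "W' \<subseteq> {..<k}" "W \<noteq> W'" for W W' and k :: nat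
  proof -
    have "\<exists>i<k. (i \<in> W) \<noteq> (i \<in> W')" using that by blast
    then obtain i where i: "i < k" "(i \<in> W) \<noteq> (i \<in> W')" by blast
    let ?j = "i * l + n"
    have j: "?j div l = i" "?j mod l = n" using l by auto
    have "Suc i * l \<le> k * l" using i(1) by (intro mult_le_mono1) simp
    then have "?j < k * l" using l(2) by simp
    moreover have "dist ((T ^^ ?j) (y W)) ((T ^^ ?j) (y W')) > e / 2"
    proof -
      have "dist ((T ^^ ?j) (y W)) (\<gamma> (i \<in> W) n) < e / 4"
        "dist ((T ^^ ?j) (y W')) (\<gamma> (i \<in> W') n) < e / 4"
        using y[of ?j W] y[of ?j W'] unfolding j by auto
      moreover have "dist (\<gamma> (i \<in> W) n) (\<gamma> (i \<in> W') n) > e" by (rule apart[OF i(2)])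
      ultimately show ?thesis
        using dist_triangle3[of "\<gamma> (i \<in> W) n" "\<gamma> (i \<in> W') n" "(T ^^ ?j) (y W)"]
          dist_triangle[of "(T ^^ ?j) (y W)" "\<gamma> (i \<in> W') n" "(T ^^ ?j) (y W')"] by linarith
    qed
    ultimately show ?thesis by blast
  qed
  let ?h = "\<lambda>n. SUP E\<in>{E. finite E \<and> separated_set T n (e / 2) E}. ereal (ln (real (card E)) / real n)"
  have growth: "ereal (ln 2 / real l) \<le> ?h (k * l)" if k: "k > 0" for k
  proof -
    let ?E = "y ` Pow {..<k}"
    have "inj_on y (Pow {..<k})"
    proof (rule inj_onI, rule ccontr)
      fix W W' assume "W \<in> Pow {..<k}" "W' \<in> Pow {..<k}" "y W = y W'" "W \<noteq> W'"
      then show False using sep[of W k W'] e by auto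
    qed
    then have "card ?E = 2 ^ k" by (simp add: card_image card_Pow)
    then have "ln (real (card ?E)) / real (k * l) = ln 2 / real l"
      using k by (simp add: ln_realpow)
    moreover have "separated_set T (k * l) (e / 2) ?E"
      unfolding separated_set_def
    proof (intro ballI impI)
      fix a b assume "a \<in> ?E" "b \<in> ?E" "a \<noteq> b"
      then obtain W W' where "a = y W" "b = y W'" "W \<subseteq> {..<k}" "W' \<subseteq> {..<k}" "W \<noteq> W'" by blast
      then show "\<exists>j<k * l. dist ((T ^^ j) a) ((T ^^ j) b) > e / 2" using sep by blast
    qed
    ultimately show ?thesis by (intro SUP_upper2[of ?E]) auto
  qed
  have "ereal (ln 2 / real l) \<le> limsup ?h"
  proof (rule le_limsup_if_frequently)
    fix N
    have "Suc N * l \<ge> Suc N * 1" using l(1) by (intro mult_le_mono2) simp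
    then have "Suc N * l \<ge> N" by simp
    then show "\<exists>n\<ge>N. ereal (ln 2 / real l) \<le> ?h n" using growth[of "Suc N"] by blast
  qed
  also have "\<dots> \<le> topological_entropy T"
    unfolding topological_entropy_def using e by (intro SUP_upper) simp
  finally have "ereal (ln 2 / real l) \<le> topological_entropy T" .
  moreover have "ereal (ln 2 / real l) > 0" using l(1) by simp
  ultimately show ?thesis by (rule less_le_trans[rotated])
qed

section \<open>Consequences of shadowing for non-uniquely ergodic transitive maps\<close>

theorem theorem3:
  fixes T :: "'a::metric_space \<Rightarrow> 'a"
  assumes "compact (UNIV :: 'a set)"
    and "\<forall>x::'a. \<not> x isolated_in UNIV"
    and "continuous_on UNIV T"
    and "top_transitive T"
    and "\<not> uniquely_ergodic T"
    and "shadowing_property T"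
  shows "irregular_observables T \<noteq> {}
    \<and> topological_entropy T > 0
    \<and> measure_center T = UNIV
    \<and> closure (\<Union>\<mu>\<in>ergodic_measures T. basin T \<mu>) = UNIV
    \<and> baire_generic (completely_irregular_points T)
    \<and> sensitive T"
proof -
  note comp = assms(1) and T = assms(3) and trans = assms(4) and shad = assms(6)
  have ergodic_dense: "\<exists>z \<mu>. dist x z < e \<and> \<mu> \<in> ergodic_measures T \<and> z \<in> basin T \<mu>
      \<and> z \<in> measure_support \<mu>" if "e > 0" for x :: 'a and e
    using dense_limit_periodic_orbits[OF comp T trans shad that, of x]
      limit_periodic_orbit_ergodic_measure[OF comp T] by metis
  have ergodic_invariant: "\<mu> \<in> invariant_measures T" if "\<mu> \<in> ergodic_measures T" for \<mu>
    using that by (simp add: ergodic_measures_def)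
  have center: "measure_center T = UNIV"
  proof -
    have "x \<in> measure_center T" for x
      unfolding measure_center_def closure_approachable
    proof (intro allI impI)
      fix e :: real assume "e > 0"
      then obtain z \<mu> where "dist x z < e" "\<mu> \<in> ergodic_measures T" "z \<in> measure_support \<mu>"
        using ergodic_dense by blast
      then have "z \<in> (\<Union>\<mu>\<in>invariant_measures T. measure_support \<mu>)" "dist z x < e"
        using ergodic_invariant by (auto simp: dist_commute)
      then show "\<exists>z\<in>\<Union>\<mu>\<in>invariant_measures T. measure_support \<mu>. dist z x < e" by (rule bexI[rotated])
    qed
    then show ?thesis by blast
  qed
  have basins: "closure (\<Union>\<mu>\<in>ergodic_measures T. basin T \<mu>) = UNIV"
  proof -
    have "x \<in> closure (\<Union>\<mu>\<in>ergodic_measures T. basin T \<mu>)" for x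
      unfolding closure_approachable
    proof (intro allI impI)
      fix e :: real assume "e > 0"
      then obtain z \<mu> where "dist x z < e" "\<mu> \<in> ergodic_measures T" "z \<in> basin T \<mu>"
        using ergodic_dense by blast
      then have "z \<in> (\<Union>\<mu>\<in>ergodic_measures T. basin T \<mu>)" "dist z x < e"
        by (auto simp: dist_commute)
      then show "\<exists>z\<in>\<Union>\<mu>\<in>ergodic_measures T. basin T \<mu>. dist z x < e" by (rule bexI[rotated])
    qed
    then show ?thesis by blast
  qed
  obtain \<mu> where \<mu>: "\<mu> \<in> invariant_measures T"
    using ergodic_dense[of 1] ergodic_invariant by (metis zero_less_one)
  then obtain \<nu> where \<nu>: "\<nu> \<in> invariant_measures T" "\<mu> \<noteq> \<nu>"
    using assms(5) unfolding uniquely_ergodic_def by metis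
  obtain \<phi> c d y y' where \<phi>: "continuous_on UNIV \<phi>" and cd: "c < d"
    and y: "\<exists>\<^sub>F n in sequentially. birkhoff_average T \<phi> y n \<le> c"
    and y': "\<exists>\<^sub>F n in sequentially. d \<le> birkhoff_average T \<phi> y' n"
    using distinct_invariant_measures_gap[OF comp T \<mu> \<nu>] by blast
  obtain \<G> where \<G>: "countable \<G>" "\<And>G. G \<in> \<G> \<Longrightarrow> open G \<and> closure G = UNIV"
    and upper: "\<And>x y \<phi> c c'. x \<in> \<Inter>\<G> \<Longrightarrow> continuous_on UNIV \<phi> \<Longrightarrow> c < c'
      \<Longrightarrow> \<exists>\<^sub>F n in sequentially. c' \<le> birkhoff_average T \<phi> y n
      \<Longrightarrow> \<exists>\<^sub>F n in sequentially. c \<le> birkhoff_average T \<phi> x n"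
    and lower: "\<And>x y \<phi> c c'. x \<in> \<Inter>\<G> \<Longrightarrow> continuous_on UNIV \<phi> \<Longrightarrow> c' < c
      \<Longrightarrow> \<exists>\<^sub>F n in sequentially. birkhoff_average T \<phi> y n \<le> c'
      \<Longrightarrow> \<exists>\<^sub>F n in sequentially. birkhoff_average T \<phi> x n \<le> c"
    by (rule generic_points_have_extremal_averages[OF comp T trans shad]) blast
  have oscillates: "\<exists>c' d'. c' < d' \<and>
      (\<forall>x\<in>\<Inter>\<G>. (\<exists>\<^sub>F n in sequentially. birkhoff_average T \<psi> x n \<le> c') \<and>
        (\<exists>\<^sub>F n in sequentially. d' \<le> birkhoff_average T \<psi> x n))"
    if \<psi>: "continuous_on UNIV \<psi>" and ab: "a < b"
      and w: "\<exists>\<^sub>F n in sequentially. birkhoff_average T \<psi> w n \<le> a"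
      and w': "\<exists>\<^sub>F n in sequentially. b \<le> birkhoff_average T \<psi> w' n" for \<psi> a b w w'
  proof -
    \<comment> \<open>passing to generic points costs an arbitrarily small margin on either side; use a third of the gap\<close>
    have "a < (2 * a + b) / 3" "(2 * a + b) / 3 < (a + 2 * b) / 3" "(a + 2 * b) / 3 < b"
      using ab by auto
    then show ?thesis using lower[OF _ \<psi> _ w] upper[OF _ \<psi> _ w'] by blast
  qed
  obtain c' d' where cd': "c' < d'"
    and osc: "\<And>x. x \<in> \<Inter>\<G> \<Longrightarrow> \<exists>\<^sub>F n in sequentially. birkhoff_average T \<phi> x n \<le> c'"
      "\<And>x. x \<in> \<Inter>\<G> \<Longrightarrow> \<exists>\<^sub>F n in sequentially. d' \<le> birkhoff_average T \<phi> x n"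
    using oscillates[OF \<phi> cd y y'] by blast
  have dense: "closure (\<Inter>\<G>) = UNIV" by (rule compact_dense_Inter[OF comp \<G>])
  have generic_near: "\<exists>g\<in>\<Inter>\<G>. dist x g < e" if "e > 0" for x e
    using dense that unfolding closure_approachable[of x "\<Inter>\<G>", symmetric]
    by (metis UNIV_I closure_approachable dist_commute)
  have sens: "sensitive T"
  proof (rule sensitive_if_oscillation_and_convergence_dense[OF comp \<phi> cd'])
    fix x :: 'a and e :: real assume e: "e > 0"
    show "\<exists>g. dist x g < e \<and> (\<exists>\<^sub>F n in sequentially. birkhoff_average T \<phi> g n \<le> c')
        \<and> (\<exists>\<^sub>F n in sequentially. d' \<le> birkhoff_average T \<phi> g n)"
      using generic_near[OF e, of x] osc by blast
    obtain z \<mu> where "dist x z < e" "z \<in> basin T \<mu>" using ergodic_dense[OF e] by blast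
    then show "\<exists>z. dist x z < e \<and> convergent (birkhoff_average T \<phi> z)"
      using \<phi> unfolding basin_def convergent_def by blast
  qed
  have "irregular_observables T \<noteq> {}"
  proof -
    obtain g where "g \<in> \<Inter>\<G>" using generic_near[OF zero_less_one] by blast
    then have "g \<in> irregular_points T \<phi>"
      using oscillates_imp_divergent[OF cd'] osc by (simp add: irregular_points_def)
    then show ?thesis using \<phi> by (auto simp: irregular_observables_def)
  qed
  moreover have "\<Inter>\<G> \<subseteq> completely_irregular_points T"
  proof
    fix x assume x: "x \<in> \<Inter>\<G>"
    have "x \<in> irregular_points T \<psi>" if "\<psi> \<in> irregular_observables T" for \<psi>
    proof -
      from that obtain w where \<psi>: "continuous_on UNIV \<psi>"
        and w: "\<not> convergent (birkhoff_average T \<psi> w)"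
        by (auto simp: irregular_observables_def irregular_points_def)
      obtain B where "\<And>x. \<bar>\<psi> x\<bar> \<le> B"
        using compact_imp_continuous_bounded[OF comp \<psi>] by blast
      then obtain a b where ab: "a < b"
        "\<exists>\<^sub>F n in sequentially. birkhoff_average T \<psi> w n \<le> a"
        "\<exists>\<^sub>F n in sequentially. b \<le> birkhoff_average T \<psi> w n"
        using bounded_divergent_oscillates[OF _ w] abs_birkhoff_average_le by metis
      from oscillates[OF \<psi> ab] x show ?thesis
        using oscillates_imp_divergent unfolding irregular_points_def by blast
    qed
    then show "x \<in> completely_irregular_points T" by (simp add: completely_irregular_points_def)
  qed
  then have "baire_generic (completely_irregular_points T)"
    unfolding baire_generic_def using \<G> by blast
  moreover have "topological_entropy T > 0"
    by (rule sensitive_shadowing_positive_entropy[OF T trans shad sens])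
  ultimately show ?thesis using center basins sens by blast
qed

end
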